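(* Let $\varphi$ be the map from the lattice of subvarieties of $\mathsf{V}(S_7^0)$ to the lattice of subvarieties of $\mathsf{V}(S_7)$ given by $\varphi(\mathcal V)=\mathcal V\cap \mathsf{V}(S_7)$. Then: (1) $\varphi^{-1}(\mathbf{T})=\{\mathbf{T},\mathsf{V}(D_2)\}$; (2) $\varphi^{-1}(\mathsf{V}(M_2))=\{\mathsf{V}(M_2),\mathsf{V}(M_2,D_2),\mathsf{V}(M_2^0)\}$; (3) $\varphi^{-1}(\mathsf{V}(T_2))=[\mathsf{V}(T_2),\mathsf{V}(T_2^0)]$; (4) $\varphi^{-1}(\mathsf{V}(S_c(ab)))=[\mathsf{V}(S_c(ab)),\mathsf{V}(S_c(ab)^0)]$; (5) $\varphi^{-1}(\mathsf{V}(M_2,T_2))=[\mathsf{V}(M_2,T_2),\mathsf{V}(M_2^0,T_2^0)]$; (6) $\varphi^{-1}(\mathsf{V}(M_2,S_c(ab)))=[\mathsf{V}(M_2,S_c(ab)),\mathsf{V}(M_2^0,S_c(ab)^0)]$.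
   Context: An ai-semiring is an algebra $(S,+,\cdot)$ such that $(S,+)$ is a commutative idempotent semigroup, $(S,\cdot)$ is a semigroup, and multiplication distributes over addition on both sides. $\mathsf{V}(S_1,\dots,S_k)$ denotes the variety generated by $S_1,\dots,S_k$, and $\mathbf T$ is the trivial variety. For varieties $\mathcal A\le\mathcal B$ (inclusion), $[\mathcal A,\mathcal B]$ is the set of varieties $\mathcal V$ with $\mathcal A\le\mathcal V\le\mathcal B$. Two-element ai-semirings on $\{0,1\}$, all with addition $x+y=\max(x,y)$: $M_2$ has $xy=\max(x,y)$; $D_2$ has $xy=\min(x,y)$; $T_2$ has $xy=1$ for all $x,y$. $S_7=\{1,a,\infty\}$ is the commutative ai-semiring with $x+x=x$, $x+y=\infty$ if $x\ne y$, and $1\cdot x=x$ for all $x$, $a\cdot a=\infty$, $\infty\cdot x=\infty$ for all $x$. $S_c(ab)=\{a,b,ab,\infty\}$ is the commutative ai-semiring with $u+u=u$, $u+v=\infty$ for $u\ne v$, $a\cdot b=b\cdot a=ab$ and all other products equal to $\infty$. For an ai-semiring $S$, $S^0$ denotes $S\cup\{0\}$, where $0$ is a new element with $0+s=s+0=s$ and $0s=s0=0$ for all $s\in S\cup\{0\}$. *)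

theory Defs
  imports "HOL-Library.FuncSet"
begin

record 'a alg =
  carrier :: "'a set"
  plus :: "'a \<Rightarrow> 'a \<Rightarrow> 'a"
  times :: "'a \<Rightarrow> 'a \<Rightarrow> 'a"

locale ai_semiring =
  fixes S :: "'a alg"
  assumes nonempty: "carrier S \<noteq> {}"
    and plus_closed: "\<lbrakk>x \<in> carrier S; y \<in> carrier S\<rbrakk> \<Longrightarrow> plus S x y \<in> carrier S"
    and times_closed: "\<lbrakk>x \<in> carrier S; y \<in> carrier S\<rbrakk> \<Longrightarrow> times S x y \<in> carrier S"
    and plus_assoc: "\<lbrakk>x \<in> carrier S; y \<in> carrier S; z \<in> carrier S\<rbrakk>
      \<Longrightarrow> plus S (plus S x y) z = plus S x (plus S y z)"
    and plus_commute: "\<lbrakk>x \<in> carrier S; y \<in> carrier S\<rbrakk> \<Longrightarrow> plus S x y = plus S y x"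
    and plus_idem: "x \<in> carrier S \<Longrightarrow> plus S x x = x"
    and times_assoc: "\<lbrakk>x \<in> carrier S; y \<in> carrier S; z \<in> carrier S\<rbrakk>
      \<Longrightarrow> times S (times S x y) z = times S x (times S y z)"
    and distrib_left: "\<lbrakk>x \<in> carrier S; y \<in> carrier S; z \<in> carrier S\<rbrakk>
      \<Longrightarrow> times S x (plus S y z) = plus S (times S x y) (times S x z)"
    and distrib_right: "\<lbrakk>x \<in> carrier S; y \<in> carrier S; z \<in> carrier S\<rbrakk>
      \<Longrightarrow> times S (plus S x y) z = plus S (times S x z) (times S y z)"

definition hom :: "'a alg \<Rightarrow> 'b alg \<Rightarrow> ('a \<Rightarrow> 'b) set" where
  "hom A B = {h. h \<in> carrier A \<rightarrow> carrier B \<and>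
     (\<forall>x\<in>carrier A. \<forall>y\<in>carrier A.
        h (plus A x y) = plus B (h x) (h y) \<and> h (times A x y) = times B (h x) (h y))}"

definition subuniverse :: "'a set \<Rightarrow> 'a alg \<Rightarrow> bool" where
  "subuniverse U A \<longleftrightarrow> U \<noteq> {} \<and> U \<subseteq> carrier A \<and>
     (\<forall>x\<in>U. \<forall>y\<in>U. plus A x y \<in> U \<and> times A x y \<in> U)"

definition prod_alg :: "'i set \<Rightarrow> ('i \<Rightarrow> 'a alg) \<Rightarrow> ('i \<Rightarrow> 'a) alg" where
  "prod_alg I A =
     \<lparr>carrier = (\<Pi>\<^sub>E i\<in>I. carrier (A i)),
      plus = (\<lambda>f g. \<lambda>i\<in>I. plus (A i) (f i) (g i)),
      times = (\<lambda>f g. \<lambda>i\<in>I. times (A i) (f i) (g i))\<rparr>"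

definition Hom_images :: "'a alg set \<Rightarrow> 'b alg set" where
  "Hom_images K = {B. \<exists>A\<in>K. \<exists>h\<in>hom A B. h ` carrier A = carrier B}"

definition Subalgebras :: "'a alg set \<Rightarrow> 'a alg set" where
  "Subalgebras K = {A\<lparr>carrier := U\<rparr> |A U. A \<in> K \<and> subuniverse U A}"

definition Products :: "'a alg set \<Rightarrow> ('i \<Rightarrow> 'a) alg set" where
  "Products K = {prod_alg I A |I A. \<forall>i\<in>I. A i \<in> K}"

text \<open>
  A variety is represented by the class of its members whose carrier is a subset of a fixed
  infinite type \<open>'u\<close>. Each variety is determined by these members, because its free algebra
  on countably many generators has a copy in \<open>'u\<close>.

  Closure under products cannot be required separately, since a product of members need not fit
  into \<open>'u\<close>; the three closure conditions are therefore imposed jointly, as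
  \<open>HSP(\<V>) \<subseteq> \<V>\<close>, with the product and its subalgebra living in the
  function type. Products indexed by subsets of \<open>'u\<close> suffice: an algebra on \<open>'u\<close>
  that is a homomorphic image of a subalgebra of some product is already an image of a subalgebra
  with at most \<open>|'u|\<close> elements, whose points are separated by at most
  \<open>|'u|\<close> coordinates.  The index set may be empty, so trivial algebras always belong.
\<close>

definition variety :: "'u alg set \<Rightarrow> bool" where
  "variety \<V> \<longleftrightarrow> (\<forall>A\<in>\<V>. ai_semiring A) \<and>
     Hom_images (Subalgebras (Products \<V> :: ('u \<Rightarrow> 'u) alg set)) \<subseteq> \<V>"

definition Var :: "'u alg set \<Rightarrow> 'u alg set" where
  "Var K = \<Inter>{\<V>. variety \<V> \<and> K \<subseteq> \<V>}"

text \<open>The generating algebras live on types of their own; \<open>copies S\<close> is the class of all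
  isomorphic copies of \<open>S\<close> on \<open>'u\<close>, so that \<open>V(S, T)\<close> is
  \<open>Var (copies S \<union> copies T)\<close>.\<close>

definition copies :: "'a alg \<Rightarrow> 'u alg set" where
  "copies S = {A. \<exists>h\<in>hom S A. bij_betw h (carrier S) (carrier A)}"

definition trivial_variety :: "'u alg set" where
  "trivial_variety = {A. ai_semiring A \<and> (\<exists>x. carrier A = {x})}"

definition subvarieties :: "'u alg set \<Rightarrow> 'u alg set set" where
  "subvarieties \<W> = {\<V>. variety \<V> \<and> \<V> \<subseteq> \<W>}"

definition interval :: "'u alg set \<Rightarrow> 'u alg set \<Rightarrow> 'u alg set set" where
  "interval \<A> \<B> = {\<V>. variety \<V> \<and> \<A> \<subseteq> \<V> \<and> \<V> \<subseteq> \<B>}"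

definition M2 :: "nat alg" where
  "M2 = \<lparr>carrier = {0, 1}, plus = max, times = max\<rparr>"

definition D2 :: "nat alg" where
  "D2 = \<lparr>carrier = {0, 1}, plus = max, times = min\<rparr>"

definition T2 :: "nat alg" where
  "T2 = \<lparr>carrier = {0, 1}, plus = max, times = (\<lambda>x y. 1)\<rparr>"

datatype s7 = S7_one | S7_a | S7_inf

definition S7 :: "s7 alg" where
  "S7 = \<lparr>carrier = UNIV,
     plus = (\<lambda>x y. if x = y then x else S7_inf),
     times = (\<lambda>x y. if x = S7_one then y else if y = S7_one then x else S7_inf)\<rparr>"

datatype sc = Sc_a | Sc_b | Sc_ab | Sc_inf

definition Sc_alg :: "sc alg" where
  "Sc_alg = \<lparr>carrier = UNIV,
     plus = (\<lambda>x y. if x = y then x else Sc_inf),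
     times = (\<lambda>x y. if {x, y} = {Sc_a, Sc_b} then Sc_ab else Sc_inf)\<rparr>"

text \<open>\<open>None\<close> is the new element of \<open>S\<^sup>0\<close>.\<close>

definition adjoin_zero :: "'a alg \<Rightarrow> 'a option alg" where
  "adjoin_zero S =
     \<lparr>carrier = insert None (Some ` carrier S),
      plus = (\<lambda>x y. case (x, y) of
         (None, _) \<Rightarrow> y | (_, None) \<Rightarrow> x | (Some s, Some t) \<Rightarrow> Some (plus S s t)),
      times = (\<lambda>x y. case (x, y) of
         (Some s, Some t) \<Rightarrow> Some (times S s t) | _ \<Rightarrow> None)\<rparr>"

lemma ai_semiring_M2: "ai_semiring M2"
  by unfold_locales (auto simp: M2_def)

lemma ai_semiring_D2: "ai_semiring D2"
  by unfold_locales (auto simp: D2_def)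

lemma ai_semiring_T2: "ai_semiring T2"
  by unfold_locales (auto simp: T2_def)

lemma ai_semiring_S7: "ai_semiring S7"
proof
  fix x y z
  show "times S7 x (plus S7 y z) = plus S7 (times S7 x y) (times S7 x z)"
    by (cases x; cases y; cases z) (simp_all add: S7_def)
  show "times S7 (plus S7 x y) z = plus S7 (times S7 x z) (times S7 y z)"
    by (cases x; cases y; cases z) (simp_all add: S7_def)
  show "times S7 (times S7 x y) z = times S7 x (times S7 y z)"
    by (cases x; cases y; cases z) (simp_all add: S7_def)
qed (auto simp: S7_def)

lemma ai_semiring_Sc: "ai_semiring Sc_alg"
proof
  show "times Sc_alg x (plus Sc_alg y z) = plus Sc_alg (times Sc_alg x y) (times Sc_alg x z)" for x y z
    by (cases x; cases y; cases z) (auto simp: Sc_alg_def doubleton_eq_iff)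
  show "times Sc_alg (plus Sc_alg x y) z = plus Sc_alg (times Sc_alg x z) (times Sc_alg y z)" for x y z
    by (cases x; cases y; cases z) (auto simp: Sc_alg_def doubleton_eq_iff)
qed (auto simp: Sc_alg_def doubleton_eq_iff)

lemma ai_semiring_adjoin_zero:
  assumes "ai_semiring S" shows "ai_semiring (adjoin_zero S)"
proof -
  interpret ai_semiring S by fact
  show ?thesis
    by unfold_locales
      (auto simp: adjoin_zero_def plus_closed times_closed plus_assoc plus_idem times_assoc
         distrib_left distrib_right intro: plus_commute)
qed

lemma ai_semiring_hom_image:
  assumes "ai_semiring A" "h \<in> hom A B" "h ` carrier A = carrier B"
  shows "ai_semiring B"
proof -
  interpret ai_semiring A by fact
  have p: "plus B (h x) (h y) = h (plus A x y)" and t: "times B (h x) (h y) = h (times A x y)"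
    if "x \<in> carrier A" "y \<in> carrier A" for x y
    using assms(2) that by (auto simp: hom_def)
  show ?thesis
  proof
    fix x y z assume "x \<in> carrier B" "y \<in> carrier B" "z \<in> carrier B"
    then obtain x' y' z' where eq: "x = h x'" "y = h y'" "z = h z'"
      and m: "x' \<in> carrier A" "y' \<in> carrier A" "z' \<in> carrier A"
      using assms(3) by blast
    note c = plus_closed[OF m(1,2)] plus_closed[OF m(2,3)] times_closed[OF m(1,2)]
      times_closed[OF m(2,3)] times_closed[OF m(1,3)]
    show "plus B (plus B x y) z = plus B x (plus B y z)"
      unfolding eq by (simp only: p m c plus_assoc)
    show "times B (times B x y) z = times B x (times B y z)"
      unfolding eq by (simp only: t m c times_assoc)
    show "times B x (plus B y z) = plus B (times B x y) (times B x z)"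
      unfolding eq by (simp only: p t m c distrib_left)
    show "times B (plus B x y) z = plus B (times B x z) (times B y z)"
      unfolding eq by (simp only: p t m c distrib_right)
  next
    fix x y assume "x \<in> carrier B" "y \<in> carrier B"
    then obtain x' y' where eq: "x = h x'" "y = h y'"
      and m: "x' \<in> carrier A" "y' \<in> carrier A"
      using assms(3) by blast
    show "plus B x y = plus B y x"
      unfolding eq p[OF m] p[OF m(2,1)] plus_commute[OF m] ..
    show "plus B x y \<in> carrier B" "times B x y \<in> carrier B"
      unfolding eq p[OF m] t[OF m] using plus_closed[OF m] times_closed[OF m] assms(3) by auto
  next
    fix x assume "x \<in> carrier B"
    then show "plus B x x = x" using assms(3) p plus_idem by force
  qed (use nonempty assms(3) in auto)
qed

lemma ai_semiring_HSP:
  fixes K :: "'a alg set" and C :: "'b alg"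
  assumes "\<forall>A\<in>K. ai_semiring A"
    and "C \<in> Hom_images (Subalgebras (Products K :: ('i \<Rightarrow> 'a) alg set))"
  shows "ai_semiring C"
proof -
  obtain P :: "('i \<Rightarrow> 'a) alg" and U h where P: "P \<in> Products K" and U: "subuniverse U P"
    and h: "h \<in> hom (P\<lparr>carrier := U\<rparr>) C" "h ` U = carrier C"
    using assms(2) unfolding Hom_images_def Subalgebras_def by auto
  obtain I A where P: "P = prod_alg I A" and A: "\<forall>i\<in>I. A i \<in> K"
    using P unfolding Products_def by blast
  note U = U[unfolded P] and h = h[unfolded P]
  have A: "ai_semiring (A i)" if "i \<in> I" for i using A assms(1) that by blast
  have U': "U \<noteq> {}" "\<And>x. x \<in> U \<Longrightarrow> x \<in> (\<Pi>\<^sub>E i\<in>I. carrier (A i))"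
    "\<And>x y. x \<in> U \<Longrightarrow> y \<in> U \<Longrightarrow> plus (prod_alg I A) x y \<in> U"
    "\<And>x y. x \<in> U \<Longrightarrow> y \<in> U \<Longrightarrow> times (prod_alg I A) x y \<in> U"
    using U by (auto simp: subuniverse_def prod_alg_def)
  have mem: "x i \<in> carrier (A i)" if "x \<in> U" "i \<in> I" for x i
    using U'(2)[OF that(1)] that(2) by (auto simp: PiE_def Pi_def)
  have ext: "(\<lambda>i\<in>I. x i) = x" if "x \<in> U" for x
    using U'(2)[OF that] by (simp add: PiE_restrict)
  have "ai_semiring ((prod_alg I A)\<lparr>carrier := U\<rparr>)" (is "ai_semiring ?B")
  proof
    fix x y z assume "x \<in> carrier ?B" "y \<in> carrier ?B" "z \<in> carrier ?B"
    then have xyz: "x \<in> U" "y \<in> U" "z \<in> U" by auto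
    note m = xyz[THEN mem]
    show "plus ?B (plus ?B x y) z = plus ?B x (plus ?B y z)"
      by (auto simp: prod_alg_def m ai_semiring.plus_assoc[OF A] intro!: restrict_ext)
    show "times ?B (times ?B x y) z = times ?B x (times ?B y z)"
      by (auto simp: prod_alg_def m ai_semiring.times_assoc[OF A] intro!: restrict_ext)
    show "times ?B x (plus ?B y z) = plus ?B (times ?B x y) (times ?B x z)"
      by (auto simp: prod_alg_def m ai_semiring.distrib_left[OF A] intro!: restrict_ext)
    show "times ?B (plus ?B x y) z = plus ?B (times ?B x z) (times ?B y z)"
      by (auto simp: prod_alg_def m ai_semiring.distrib_right[OF A] intro!: restrict_ext)
  next
    fix x y assume "x \<in> carrier ?B" "y \<in> carrier ?B"
    then have xy: "x \<in> U" "y \<in> U" by auto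
    show "plus ?B x y = plus ?B y x"
      by (auto simp: prod_alg_def xy[THEN mem]
            intro!: restrict_ext ai_semiring.plus_commute[OF A])
    show "plus ?B x y \<in> carrier ?B" "times ?B x y \<in> carrier ?B"
      using U'(3,4) xy by (auto simp: prod_alg_def)
  next
    fix x assume "x \<in> carrier ?B"
    then have x: "x \<in> U" by simp
    have "plus ?B x x = (\<lambda>i\<in>I. x i)"
      by (auto simp: prod_alg_def mem[OF x] ai_semiring.plus_idem[OF A] intro!: restrict_ext)
    then show "plus ?B x x = x" using ext[OF x] by simp
  qed (use U'(1) in simp)
  then show ?thesis using h(2) by (intro ai_semiring_hom_image[OF _ h(1)]) simp_all
qed

lemma variety_all: "variety {A. ai_semiring A}"
  unfolding variety_def using ai_semiring_HSP[of "{A. ai_semiring A}"] by auto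

lemma variety_Inter:
  assumes "X \<noteq> {}" "\<forall>\<V>\<in>X. variety \<V>" shows "variety (\<Inter>X)"
proof -
  have "Hom_images (Subalgebras (Products (\<Inter>X) :: ('a \<Rightarrow> 'a) alg set)) \<subseteq> \<V>"
    if "\<V> \<in> X" for \<V>
  proof -
    have "Products (\<Inter>X) \<subseteq> (Products \<V> :: ('a \<Rightarrow> 'a) alg set)"
      unfolding Products_def using Inter_lower[OF that] by fast
    then have "Subalgebras (Products (\<Inter>X)) \<subseteq> Subalgebras (Products \<V> :: ('a \<Rightarrow> 'a) alg set)"
      unfolding Subalgebras_def by fast
    then have "Hom_images (Subalgebras (Products (\<Inter>X) :: ('a \<Rightarrow> 'a) alg set))
        \<subseteq> (Hom_images (Subalgebras (Products \<V> :: ('a \<Rightarrow> 'a) alg set)) :: 'a alg set)"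
      unfolding Hom_images_def by fast
    then show ?thesis using assms(2) that unfolding variety_def by blast
  qed
  then show ?thesis using assms unfolding variety_def by blast
qed

lemma variety_Var: "K \<subseteq> {A. ai_semiring A} \<Longrightarrow> variety (Var K)"
  unfolding Var_def using variety_all by (intro variety_Inter) auto

lemma ai_semiring_copies: "ai_semiring S \<Longrightarrow> copies S \<subseteq> {A. ai_semiring A}"
  unfolding copies_def bij_betw_def using ai_semiring_hom_image[of S] by blast

text \<open>Hence intersecting with a variety maps subvarieties to subvarieties.\<close>

lemma subvarieties_Int:
  "\<lbrakk>variety \<W>; \<V> \<in> subvarieties \<U>\<rbrakk> \<Longrightarrow> \<V> \<inter> \<W> \<in> subvarieties \<W>"
  using variety_Inter[of "{\<V>, \<W>}"] by (auto simp: subvarieties_def)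

end

theory Submission
  imports Defs "HOL-Library.Multiset" "HOL-Combinatorics.Transposition"
begin

text \<open>
  Everything is done with inequalities \<open>q \<le> w\<^sub>1 + \<dots> + w\<^sub>k\<close> between words, since an identity
  between sums of words is a conjunction of such inequalities. By Birkhoff's theorem
  (\<open>birkhoff\<close>) a variety is determined by the inequalities valid in it, so that inclusions
  between varieties become deductions.

  \<^bold>\<open>One family for six cases.\<close> Let \<open>Sc_gen n\<close> be the semiring of nonempty subsets of an
  \<open>n\<close>-element set with idempotent addition, disjoint union as product and all other results
  equal to \<open>\<infinity>\<close>, that is, \<open>S\<^sub>c(a\<^sub>1\<dots>a\<^sub>n)\<close>. For \<open>n = 0, 1, 2\<close> it is trivial, \<open>T\<^sub>2\<close> and
  \<open>S\<^sub>c(ab)\<close>. So the six varieties below \<open>V(S\<^sub>7)\<close> in the proposition are those generated by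
  \<open>Sc_gen n\<close> with \<open>n \<le> 2\<close>, with or without \<open>M\<^sub>2\<close>; they are called \<open>base n m\<close>, and \<open>base_zero
  n m\<close> is the variety generated by the same semirings with a zero adjoined. The claim is
  that the preimage of \<open>base n m\<close> is the interval from \<open>base n m\<close> to \<open>base_zero n m\<close>
  (\<open>preimage_eq_interval\<close>).

  \<^bold>\<open>Effect of a zero.\<close> An inequality \<open>q \<le> u\<close> holds in \<open>S\<^sup>0\<close> iff it holds in \<open>S\<close> after all
  words of \<open>u\<close> with a letter foreign to \<open>q\<close> are deleted, and some word is left
  (\<open>sat_adjoin_zero\<close>): set the letters foreign to \<open>q\<close> to zero. Hence an inequality of \<open>S\<^sub>7\<close>
  whose right-hand side has no foreign letters is valid in all subvarieties of \<open>V(S\<^sub>7\<^sup>0)\<close>.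

  \<^bold>\<open>The upper end.\<close> Let \<open>\<V> \<subseteq> V(S\<^sub>7\<^sup>0)\<close> meet \<open>V(S\<^sub>7)\<close> in \<open>base n m\<close>. All \<open>Sc_gen k\<close> and \<open>M\<^sub>2\<close>
  lie in \<open>V(S\<^sub>7)\<close>, so \<open>Sc_gen (n + 1)\<close> is not in \<open>\<V>\<close>, and neither is \<open>M\<^sub>2\<close> if it is not
  among the generators. Each exclusion produces an inequality: the first yields \<open>x\<^sub>0\<^sup>2\<dots>x\<^sub>n\<^sup>2
  \<le> x\<^sub>0\<dots>x\<^sub>n\<close> (\<open>valid_square_if_not_Sc_gen\<close>), the second \<open>x\<^sup>2y\<^sup>2 \<le> x\<^sup>2\<close>
  (\<open>valid_square_if_not_M2\<close>). Now let \<open>q \<le> u\<close> hold in \<open>Sc_gen n\<close>, where \<open>u\<close> has no letters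
  foreign to \<open>q\<close>. If \<open>u\<close> takes a finite value in \<open>Sc_gen n\<close>, then its words have length at
  most \<open>n \<le> 2\<close>; they are the isolated vertices and the edges of a bipartite graph, and \<open>q \<le>
  u\<close> already holds in \<open>S\<^sub>7\<close> (\<open>sat_S7_if_finitely_valued\<close>). Otherwise the first inequality
  forces a square below \<open>u\<close> (\<open>valid_square_if_not_finitely_valued\<close>), and a square collapses
  everything: in \<open>S\<^sub>7\<close> it never has the value \<open>a\<close>, so \<open>u\<close> lies above every word with the
  same letters. These are all letters of \<open>q\<close> if \<open>M\<^sub>2\<close> is a generator, and otherwise the
  second inequality supplies the missing ones.

  \<^bold>\<open>The lower end.\<close> An algebra in \<open>base_zero n m\<close> and \<open>V(S\<^sub>7)\<close> lies in \<open>base n m\<close> by the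
  same dichotomy: if \<open>u\<close> is never finite in \<open>Sc_gen n\<close>, then the square of a word that
  contains all letters of \<open>u\<close> and \<open>q\<close> is below \<open>u\<close> in \<open>base_zero n m\<close>, and above \<open>q\<close> in
  \<open>V(S\<^sub>7)\<close>.

  \<^bold>\<open>The two finite intervals.\<close> Below \<open>V(M\<^sub>2\<^sup>0)\<close> a word is determined by its set of letters.
  There, a variety without \<open>D\<^sub>2\<close> satisfies \<open>x \<le> xy\<close>, and a variety that contains \<open>M\<^sub>2\<close> and
  \<open>D\<^sub>2\<close> but not \<open>M\<^sub>2\<^sup>0\<close> satisfies \<open>xy \<le> x + xyz\<close>; these inequalities pin the variety down.
\<close>

section \<open>Inequalities between words and sums of words\<close>

text \<open>
  Words and sums are nonempty, because an ai-semiring need have neither a zero nor a unit.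
  On the empty list the value is unspecified; \<open>ineq\<close> and \<open>polynomial\<close> below exclude that
  case.
\<close>

fun fold1 :: "('a \<Rightarrow> 'a \<Rightarrow> 'a) \<Rightarrow> 'a list \<Rightarrow> 'a" where
  "fold1 f [x] = x"
| "fold1 f (x # y # ys) = f x (fold1 f (y # ys))"

definition word_val :: "'a alg \<Rightarrow> ('v \<Rightarrow> 'a) \<Rightarrow> 'v list \<Rightarrow> 'a" where
  "word_val A \<sigma> w = fold1 (times A) (map \<sigma> w)"

definition le :: "'a alg \<Rightarrow> 'a \<Rightarrow> 'a \<Rightarrow> bool" where
  "le A x y \<longleftrightarrow> plus A x y = y"

text \<open>
  The inequality \<open>q \<le> \<Sum>u\<close>. As a sum is the least upper bound of its summands, the sum can be
  avoided: \<open>q\<close> has to lie below all upper bounds of the words in \<open>u\<close>. In a flat semiring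
  this turns every check into a comparison of values of single words.
\<close>

definition sat :: "'a alg \<Rightarrow> 'v list set \<Rightarrow> 'v list \<Rightarrow> bool" where
  "sat A u q \<longleftrightarrow> (\<forall>\<sigma> z. range \<sigma> \<subseteq> carrier A \<longrightarrow> z \<in> carrier A \<longrightarrow>
     (\<forall>w\<in>u. le A (word_val A \<sigma> w) z) \<longrightarrow> le A (word_val A \<sigma> q) z)"

definition ineq :: "'v list set \<Rightarrow> 'v list \<Rightarrow> bool" where
  "ineq u q \<longleftrightarrow> finite u \<and> u \<noteq> {} \<and> [] \<notin> u \<and> q \<noteq> []"

definition letters :: "'v list set \<Rightarrow> 'v set" where
  "letters u = (\<Union>w\<in>u. set w)"

definition subst :: "('v \<Rightarrow> 'x list) \<Rightarrow> 'v list \<Rightarrow> 'x list" where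
  "subst f w = concat (map f w)"

lemma word_val_single [simp]: "word_val A \<sigma> [x] = \<sigma> x"
  by (simp add: word_val_def)

lemma word_val_Cons: "w \<noteq> [] \<Longrightarrow> word_val A \<sigma> (x # w) = times A (\<sigma> x) (word_val A \<sigma> w)"
  by (cases w) (simp_all add: word_val_def)

lemma word_val_Cons2 [simp]:
  "word_val A \<sigma> (x # y # w) = times A (\<sigma> x) (word_val A \<sigma> (y # w))"
  by (simp add: word_val_def)

lemma word_val_map: "word_val A \<sigma> (map f w) = word_val A (\<sigma> \<circ> f) w"
  by (simp add: word_val_def)

lemma word_val_cong: "(\<And>x. x \<in> set w \<Longrightarrow> \<sigma> x = \<tau> x) \<Longrightarrow> word_val A \<sigma> w = word_val A \<tau> w"
  unfolding word_val_def by (metis map_cong)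

lemma satI:
  assumes "\<And>\<sigma> z. range \<sigma> \<subseteq> carrier A \<Longrightarrow> z \<in> carrier A \<Longrightarrow>
    (\<And>w. w \<in> u \<Longrightarrow> le A (word_val A \<sigma> w) z) \<Longrightarrow> le A (word_val A \<sigma> q) z"
  shows "sat A u q"
  using assms unfolding sat_def by blast

lemma satD:
  "\<lbrakk>sat A u q; range \<sigma> \<subseteq> carrier A; z \<in> carrier A; \<And>w. w \<in> u \<Longrightarrow> le A (word_val A \<sigma> w) z\<rbrakk>
    \<Longrightarrow> le A (word_val A \<sigma> q) z"
  unfolding sat_def by blast

lemma sat_mono: "sat A u q \<Longrightarrow> u \<subseteq> u' \<Longrightarrow> sat A u' q"
  unfolding sat_def by blast

lemma sat_mem: "q \<in> u \<Longrightarrow> sat A u q"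
  unfolding sat_def by blast

lemma sat_cut: "\<lbrakk>\<And>w. w \<in> u' \<Longrightarrow> sat A u w; sat A u' q\<rbrakk> \<Longrightarrow> sat A u q"
  by (rule satI) (rule satD[where u = u'], auto intro: satD[where u = u])

lemma subst_Nil [simp]: "subst f [] = []" and
  subst_Cons [simp]: "subst f (x # w) = f x @ subst f w" and
  subst_append [simp]: "subst f (w @ w') = subst f w @ subst f w'" and
  set_subst [simp]: "set (subst f w) = (\<Union>x\<in>set w. set (f x))"
  by (simp_all add: subst_def)

lemma subst_eq_Nil: "(\<And>x. f x \<noteq> []) \<Longrightarrow> subst f w = [] \<longleftrightarrow> w = []"
  by (cases w) auto

lemma letters_simps [simp]: "letters {} = {}" "letters (insert w u) = set w \<union> letters u"
  by (auto simp: letters_def)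

context ai_semiring
begin

lemma word_val_closed: "range \<sigma> \<subseteq> carrier S \<Longrightarrow> w \<noteq> [] \<Longrightarrow> word_val S \<sigma> w \<in> carrier S"
proof (induction w)
  case (Cons x w)
  then show ?case by (cases "w = []") (auto simp: word_val_Cons image_subset_iff intro: times_closed)
qed simp

lemma word_val_append:
  "\<lbrakk>range \<sigma> \<subseteq> carrier S; w \<noteq> []; w' \<noteq> []\<rbrakk>
    \<Longrightarrow> word_val S \<sigma> (w @ w') = times S (word_val S \<sigma> w) (word_val S \<sigma> w')"
proof (induction w)
  case (Cons x w)
  then show ?case
    by (cases "w = []") (auto simp: word_val_Cons word_val_closed image_subset_iff intro!: times_assoc[symmetric])
qed simp

lemma word_val_subst:
  assumes "range \<sigma> \<subseteq> carrier S" "\<And>x. f x \<noteq> []" "w \<noteq> []"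
  shows "word_val S \<sigma> (subst f w) = word_val S (\<lambda>x. word_val S \<sigma> (f x)) w"
  using assms(3)
proof (induction w)
  case (Cons x w)
  then show ?case using assms(1,2)
    by (cases "w = []") (auto simp: word_val_Cons word_val_append subst_eq_Nil)
qed simp

lemma le_refl: "x \<in> carrier S \<Longrightarrow> le S x x"
  by (simp add: le_def plus_idem)

lemma le_trans:
  "\<lbrakk>x \<in> carrier S; y \<in> carrier S; z \<in> carrier S; le S x y; le S y z\<rbrakk> \<Longrightarrow> le S x z"
  unfolding le_def by (metis plus_assoc)

lemma le_antisym: "\<lbrakk>x \<in> carrier S; y \<in> carrier S; le S x y; le S y x\<rbrakk> \<Longrightarrow> x = y"
  unfolding le_def by (metis plus_commute)

lemma plus_le_iff:
  "\<lbrakk>x \<in> carrier S; y \<in> carrier S; z \<in> carrier S\<rbrakk>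
    \<Longrightarrow> le S (plus S x y) z \<longleftrightarrow> le S x z \<and> le S y z"
  unfolding le_def by (metis plus_assoc plus_commute plus_idem plus_closed)

lemma times_le_right:
  "\<lbrakk>x \<in> carrier S; y \<in> carrier S; z \<in> carrier S; le S x y\<rbrakk> \<Longrightarrow> le S (times S x z) (times S y z)"
  unfolding le_def by (metis distrib_right)

lemma sat_subst:
  assumes "sat S u q" "ineq u q" "\<And>x. f x \<noteq> []"
  shows "sat S (subst f ` u) (subst f q)"
proof (rule satI)
  fix \<sigma> z assume \<sigma>: "range \<sigma> \<subseteq> carrier S" and z: "z \<in> carrier S"
    and ub: "\<And>w. w \<in> subst f ` u \<Longrightarrow> le S (word_val S \<sigma> w) z"
  have eq: "word_val S \<sigma> (subst f w) = word_val S (\<lambda>x. word_val S \<sigma> (f x)) w" if "w \<noteq> []" for w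
    using \<sigma> assms(3) that by (rule word_val_subst)
  have "le S (word_val S (\<lambda>x. word_val S \<sigma> (f x)) q) z"
  proof (rule satD[OF assms(1) _ z])
    show "range (\<lambda>x. word_val S \<sigma> (f x)) \<subseteq> carrier S"
      using word_val_closed[OF \<sigma>] assms(3) by blast
    show "le S (word_val S (\<lambda>x. word_val S \<sigma> (f x)) w) z" if "w \<in> u" for w
      using ub[OF imageI[OF that]] eq[of w] that assms(2) unfolding ineq_def by metis
  qed
  then show "le S (word_val S \<sigma> (subst f q)) z" using eq[of q] assms(2) by (simp add: ineq_def)
qed

text \<open>
  The larger side is a single word, so that monotonicity of the multiplication suffices.
\<close>

lemma sat_append:
  assumes "sat S {w} q" "w \<noteq> []" "q \<noteq> []"
  shows "sat S {w @ r} (q @ r)"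
proof (cases "r = []")
  case False
  show ?thesis
  proof (rule satI)
    fix \<sigma> z assume \<sigma>: "range \<sigma> \<subseteq> carrier S" and z: "z \<in> carrier S"
      and ub: "\<And>x. x \<in> {w @ r} \<Longrightarrow> le S (word_val S \<sigma> x) z"
    note c = word_val_closed[OF \<sigma>]
    have "le S (word_val S \<sigma> q) (word_val S \<sigma> w)"
      using assms \<sigma> c by (intro satD[OF assms(1) \<sigma>]) (auto intro: le_refl)
    then have "le S (word_val S \<sigma> (q @ r)) (word_val S \<sigma> (w @ r))"
      using assms c False \<sigma> by (simp add: word_val_append times_le_right)
    then show "le S (word_val S \<sigma> (q @ r)) z"
      using ub[of "w @ r"] assms c False z by (auto intro: le_trans[of _ "word_val S \<sigma> (w @ r)"])
  qed
qed (use assms in simp)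

end

section \<open>Inequalities and the class operators\<close>

lemma hom_word_val:
  assumes "h \<in> hom A B" "range \<sigma> \<subseteq> carrier A" "ai_semiring A" "w \<noteq> []"
  shows "h (word_val A \<sigma> w) = word_val B (h \<circ> \<sigma>) w"
  using assms(4)
proof (induction w)
  case (Cons x w)
  show ?case
  proof (cases "w = []")
    case False
    have "\<sigma> x \<in> carrier A" "word_val A \<sigma> w \<in> carrier A"
      using ai_semiring.word_val_closed[OF assms(3,2) False] assms(2) by auto
    then show ?thesis using Cons False assms(1) by (simp add: word_val_Cons hom_def)
  qed simp
qed simp

lemma hom_le:
  "\<lbrakk>h \<in> hom A B; x \<in> carrier A; y \<in> carrier A; le A x y\<rbrakk> \<Longrightarrow> le B (h x) (h y)"
  unfolding le_def hom_def by force

lemma sat_inj_hom: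
  assumes h: "h \<in> hom A B" "inj_on h (carrier A)" and A: "ai_semiring A" and u: "ineq u q"
    and sat: "sat B u q"
  shows "sat A u q"
proof (rule satI)
  interpret ai_semiring A by fact
  fix \<sigma> z assume \<sigma>: "range \<sigma> \<subseteq> carrier A" and z: "z \<in> carrier A"
    and ub: "\<And>w. w \<in> u \<Longrightarrow> le A (word_val A \<sigma> w) z"
  have q: "q \<noteq> []" using u by (simp add: ineq_def)
  have "le B (word_val B (h \<circ> \<sigma>) q) (h z)"
  proof (rule satD[OF sat])
    show "range (h \<circ> \<sigma>) \<subseteq> carrier B" "h z \<in> carrier B" using h \<sigma> z by (auto simp: hom_def)
    fix w assume "w \<in> u"
    moreover then have "w \<noteq> []" using u by (auto simp: ineq_def)
    ultimately show "le B (word_val B (h \<circ> \<sigma>) w) (h z)"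
      using hom_le[OF h(1) word_val_closed[OF \<sigma>] z ub] hom_word_val[OF h(1) \<sigma> A] by metis
  qed
  then have "h (plus A (word_val A \<sigma> q) z) = h z"
    using h(1) word_val_closed[OF \<sigma> q] z hom_word_val[OF h(1) \<sigma> A q] by (simp add: hom_def le_def)
  then show "le A (word_val A \<sigma> q) z"
    using h(2) plus_closed[OF word_val_closed[OF \<sigma> q] z] z by (auto simp: le_def inj_on_def)
qed

text \<open>
  A finite sum, described by the two properties that the transfer along a homomorphism
  needs: it bounds its summands, and its image lies below a given bound of their images.
\<close>

lemma (in ai_semiring) least_upper_bound_exists:
  assumes "finite X" "X \<noteq> {}" "X \<subseteq> carrier S" "h \<in> hom S B" "ai_semiring B" "z \<in> carrier B"
    "\<And>x. x \<in> X \<Longrightarrow> le B (h x) z"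
  shows "\<exists>s\<in>carrier S. (\<forall>x\<in>X. le S x s) \<and> le B (h s) z"
  using assms(1,2,3,7)
proof (induction rule: finite_ne_induct)
  case (singleton x)
  then show ?case by (auto intro: le_refl)
next
  case (insert x F)
  then obtain s where s: "s \<in> carrier S" "\<forall>x\<in>F. le S x s" "le B (h s) z" by auto
  have x: "x \<in> carrier S" using insert by simp
  have "le S x (plus S x s)" "le S s (plus S x s)"
    using plus_le_iff[OF x s(1) plus_closed[OF x s(1)]] le_refl[OF plus_closed[OF x s(1)]] by auto
  moreover have "le B (h (plus S x s)) z"
    using insert.prems(2)[of x] s x assms(4,6) ai_semiring.plus_le_iff[OF assms(5), of "h x" "h s" z]
    by (auto simp: hom_def)
  ultimately show ?case using s x insert.prems
    by (intro bexI[of _ "plus S x s"]) (auto intro: le_trans[of _ s] plus_closed)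
qed

text \<open>
  An upper bound in the image need not be the image of an upper bound. The sum of the words,
  computed in the domain, is one whose image lies below the given bound.
\<close>

lemma sat_hom_image:
  assumes h: "h \<in> hom A B" "h ` carrier A = carrier B" and A: "ai_semiring A" and u: "ineq u q"
    and sat: "sat A u q"
  shows "sat B u q"
proof (rule satI)
  interpret A: ai_semiring A by fact
  interpret B: ai_semiring B using ai_semiring_hom_image[OF A h] .
  fix \<sigma> z assume \<sigma>: "range \<sigma> \<subseteq> carrier B" and z: "z \<in> carrier B"
    and ub: "\<And>w. w \<in> u \<Longrightarrow> le B (word_val B \<sigma> w) z"
  have q: "q \<noteq> []" using u by (simp add: ineq_def)
  define \<tau> where "\<tau> x = inv_into (carrier A) h (\<sigma> x)" for x
  have \<tau>: "range \<tau> \<subseteq> carrier A" and eq: "h \<circ> \<tau> = \<sigma>"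
    using \<sigma> h(2) unfolding \<tau>_def
    by (force intro: inv_into_into, force simp: fun_eq_iff intro: f_inv_into_f)
  have val: "h (word_val A \<tau> w) = word_val B \<sigma> w" if "w \<noteq> []" for w
    using hom_word_val[OF h(1) \<tau> A that] eq by simp
  have "\<exists>s\<in>carrier A. (\<forall>x\<in>word_val A \<tau> ` u. le A x s) \<and> le B (h s) z"
  proof (rule A.least_upper_bound_exists[OF _ _ _ h(1) B.ai_semiring_axioms z])
    show "finite (word_val A \<tau> ` u)" "word_val A \<tau> ` u \<noteq> {}" using u by (auto simp: ineq_def)
    fix x assume "x \<in> word_val A \<tau> ` u"
    then obtain w where w: "w \<in> u" "x = word_val A \<tau> w" by auto
    then have "w \<noteq> []" using u by (auto simp: ineq_def)
    then show "le B (h x) z" using ub[OF w(1)] w(2) val by simp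
  next
    show "word_val A \<tau> ` u \<subseteq> carrier A"
      using u A.word_val_closed[OF \<tau>] by (metis image_subsetI ineq_def)
  qed
  then obtain s where s: "s \<in> carrier A" "\<forall>w\<in>u. le A (word_val A \<tau> w) s" "le B (h s) z" by auto
  have "le A (word_val A \<tau> q) s" using satD[OF sat \<tau> s(1)] s(2) by blast
  then have "le B (h (word_val A \<tau> q)) (h s)"
    using hom_le[OF h(1)] A.word_val_closed[OF \<tau> q] s(1) by blast
  then show "le B (word_val B \<sigma> q) z"
    using B.le_trans[of _ "h s" z] s val[OF q] A.word_val_closed[OF \<tau> q] z h(2) by (metis imageI)
qed

lemma sat_iso:
  assumes "h \<in> hom A B" "bij_betw h (carrier A) (carrier B)" "ai_semiring A" "ineq u q"
  shows "sat A u q \<longleftrightarrow> sat B u q"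
  using assms sat_inj_hom[of h A B u q] sat_hom_image[of h A B u q] by (auto simp: bij_betw_def)

lemma prod_alg_word_val:
  assumes "w \<noteq> []" "i \<in> I"
  shows "word_val (prod_alg I A) \<sigma> w i = word_val (A i) (\<lambda>x. \<sigma> x i) w"
  using assms(1)
proof (induction w)
  case (Cons x w)
  then show ?case using assms(2) by (cases "w = []") (auto simp: word_val_Cons prod_alg_def)
qed simp

lemma ai_semiring_subuniverse_prod:
  fixes K :: "'a alg set" and P :: "('i \<Rightarrow> 'a) alg"
  assumes "\<forall>A\<in>K. ai_semiring A" "P \<in> Products K" "subuniverse U P"
  shows "ai_semiring (P\<lparr>carrier := U\<rparr>)"
proof (rule ai_semiring_HSP[OF assms(1)])
  have "id \<in> hom (P\<lparr>carrier := U\<rparr>) (P\<lparr>carrier := U\<rparr>)" by (auto simp: hom_def)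
  moreover have "P\<lparr>carrier := U\<rparr> \<in> Subalgebras (Products K)"
    using assms(2,3) unfolding Subalgebras_def by blast
  ultimately show "P\<lparr>carrier := U\<rparr> \<in> Hom_images (Subalgebras (Products K :: ('i \<Rightarrow> 'a) alg set))"
    unfolding Hom_images_def by (auto intro!: bexI[of _ "P\<lparr>carrier := U\<rparr>"] bexI[of _ id])
qed

lemma word_val_carrier_update [simp]:
  "word_val (A\<lparr>carrier := U\<rparr>) \<sigma> w = word_val A \<sigma> w" "le (A\<lparr>carrier := U\<rparr>) = le A"
  by (simp_all add: word_val_def le_def fun_eq_iff)

lemma sat_subuniverse_prod:
  fixes K :: "'a alg set" and P :: "('i \<Rightarrow> 'a) alg"
  assumes "P \<in> Products K" "subuniverse U P" "\<forall>A\<in>K. sat A u q" "ineq u q"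
    and ai: "ai_semiring (P\<lparr>carrier := U\<rparr>)"
  shows "sat (P\<lparr>carrier := U\<rparr>) u q"
proof (rule satI)
  obtain I A where P: "P = prod_alg I A" and A: "\<And>i. i \<in> I \<Longrightarrow> A i \<in> K"
    using assms(1) unfolding Products_def by blast
  interpret U: ai_semiring "P\<lparr>carrier := U\<rparr>" by fact
  have U: "U \<subseteq> (\<Pi>\<^sub>E i\<in>I. carrier (A i))" using assms(2) by (simp add: subuniverse_def P prod_alg_def)
  have q: "q \<noteq> []" using assms(4) by (simp add: ineq_def)
  fix \<sigma> z assume \<sigma>: "range \<sigma> \<subseteq> carrier (P\<lparr>carrier := U\<rparr>)" and z: "z \<in> carrier (P\<lparr>carrier := U\<rparr>)"
    and ub: "\<And>w. w \<in> u \<Longrightarrow> le (P\<lparr>carrier := U\<rparr>) (word_val (P\<lparr>carrier := U\<rparr>) \<sigma> w) z"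
  note qU = U.word_val_closed[OF \<sigma> q]
  have z': "z \<in> (\<Pi>\<^sub>E i\<in>I. carrier (A i))" using z U by auto
  have "le (A i) (word_val (A i) (\<lambda>x. \<sigma> x i) q) (z i)" if i: "i \<in> I" for i
  proof (rule satD)
    show "sat (A i) u q" using A[OF i] assms(3) by blast
    show "range (\<lambda>x. \<sigma> x i) \<subseteq> carrier (A i)" using \<sigma> U i by fastforce
    show "z i \<in> carrier (A i)" using z' i by auto
    fix w assume w: "w \<in> u"
    then have "w \<noteq> []" using assms(4) by (auto simp: ineq_def)
    moreover have "plus P (word_val P \<sigma> w) z i = z i" using ub[OF w] by (simp add: le_def)
    ultimately show "le (A i) (word_val (A i) (\<lambda>x. \<sigma> x i) w) (z i)"
      using i prod_alg_word_val[of w i I A \<sigma>] by (auto simp: P prod_alg_def le_def)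
  qed
  then have "plus P (word_val P \<sigma> q) z = z"
    using z' prod_alg_word_val[OF q, of _ I A \<sigma>]
    by (auto simp: P le_def fun_eq_iff prod_alg_def PiE_def extensional_def)
  then show "le (P\<lparr>carrier := U\<rparr>) (word_val (P\<lparr>carrier := U\<rparr>) \<sigma> q) z" by (simp add: le_def)
qed

lemma HSP_cases:
  fixes K :: "'a alg set" and C :: "'b alg"
  assumes "C \<in> Hom_images (Subalgebras (Products K :: ('i \<Rightarrow> 'a) alg set))"
  obtains P :: "('i \<Rightarrow> 'a) alg" and U h where "P \<in> Products K" "subuniverse U P"
    "h \<in> hom (P\<lparr>carrier := U\<rparr>) C" "h ` carrier (P\<lparr>carrier := U\<rparr>) = carrier C"
proof -
  obtain A :: "('i \<Rightarrow> 'a) alg" and h where A: "A \<in> Subalgebras (Products K)" and h: "h \<in> hom A C" "h ` carrier A = carrier C"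
    using assms unfolding Hom_images_def by blast
  obtain P :: "('i \<Rightarrow> 'a) alg" and U where "P \<in> Products K" "subuniverse U P" "A = P\<lparr>carrier := U\<rparr>"
    using A unfolding Subalgebras_def by blast
  then show thesis using that h by blast
qed

text \<open>
  The easy half of Birkhoff's theorem. The letters may come from any type, so the
  inequalities of a generating semiring pass to its variety for letters of every type.
\<close>

lemma variety_sat:
  assumes "ineq u q"
  shows "variety {A :: 'u alg. ai_semiring A \<and> sat A u q}" (is "variety ?V")
proof -
  have "C \<in> ?V" if C: "C \<in> Hom_images (Subalgebras (Products ?V :: ('u \<Rightarrow> 'u) alg set))" for C :: "'u alg"
  proof -
    have ai: "\<forall>A\<in>?V. ai_semiring A" by blast
    obtain P :: "('u \<Rightarrow> 'u) alg" and U h where P: "P \<in> Products ?V" and U: "subuniverse U P"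
      and h: "h \<in> hom (P\<lparr>carrier := U\<rparr>) C" "h ` carrier (P\<lparr>carrier := U\<rparr>) = carrier C"
      using HSP_cases[OF C] .
    note aiU = ai_semiring_subuniverse_prod[OF ai P U]
    have "\<forall>A\<in>?V. sat A u q" by blast
    then show ?thesis
      using ai_semiring_HSP[OF ai C]
        sat_hom_image[OF h aiU assms sat_subuniverse_prod[OF P U _ assms aiU]] by simp
  qed
  then show ?thesis unfolding variety_def by blast
qed

lemma sat_Var:
  assumes "A \<in> Var K" "\<And>B. B \<in> K \<Longrightarrow> ai_semiring B \<and> sat B u q" "ineq u q"
  shows "sat A u q"
  using assms variety_sat[OF assms(3)] unfolding Var_def by blast

section \<open>Completeness: varieties are determined by their inequalities\<close>

text \<open>
  Unlike in \<open>sat\<close>, the sums themselves are needed here, since they are the elements of the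
  algebra constructed in \<open>birkhoff\<close>.
\<close>

definition poly_val :: "'a alg \<Rightarrow> ('v \<Rightarrow> 'a) \<Rightarrow> 'v list list \<Rightarrow> 'a" where
  "poly_val A \<sigma> us = fold1 (plus A) (map (word_val A \<sigma>) us)"

definition polynomial :: "'v list list \<Rightarrow> bool" where
  "polynomial us \<longleftrightarrow> us \<noteq> [] \<and> [] \<notin> set us"

lemma poly_val_single [simp]: "poly_val A \<sigma> [w] = word_val A \<sigma> w"
  by (simp add: poly_val_def)

lemma poly_val_Cons:
  "us \<noteq> [] \<Longrightarrow> poly_val A \<sigma> (w # us) = plus A (word_val A \<sigma> w) (poly_val A \<sigma> us)"
  by (cases us) (simp_all add: poly_val_def)

lemma polynomial_Cons:
  "polynomial (w # us) \<longleftrightarrow> w \<noteq> [] \<and> (us = [] \<or> polynomial us)"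
  by (auto simp: polynomial_def)

lemma polynomial_append: "polynomial us \<Longrightarrow> polynomial vs \<Longrightarrow> polynomial (us @ vs)"
  by (auto simp: polynomial_def)

lemma polynomial_induct [consumes 1, case_names single Cons]:
  assumes "polynomial us" "\<And>w. w \<noteq> [] \<Longrightarrow> P [w]"
    "\<And>w us. w \<noteq> [] \<Longrightarrow> polynomial us \<Longrightarrow> P us \<Longrightarrow> P (w # us)"
  shows "P us"
  using assms(1)
proof (induction us)
  case (Cons w us)
  then show ?case using assms(2,3) by (cases "us = []") (auto simp: polynomial_Cons)
qed (simp add: polynomial_def)

lemma polynomial_times: "polynomial us \<Longrightarrow> polynomial vs \<Longrightarrow> polynomial [w @ w'. w \<leftarrow> us, w' \<leftarrow> vs]"
  by (cases us; cases vs) (auto simp: polynomial_def)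

context ai_semiring
begin

lemma poly_val_closed:
  assumes "range \<sigma> \<subseteq> carrier S" "polynomial us"
  shows "poly_val S \<sigma> us \<in> carrier S"
  using assms(2)
proof (induction rule: polynomial_induct)
  case (Cons w us)
  then show ?case using assms(1)
    by (auto simp: poly_val_Cons polynomial_def intro!: plus_closed word_val_closed)
qed (use assms in \<open>auto intro!: word_val_closed\<close>)

lemma poly_val_append:
  assumes "range \<sigma> \<subseteq> carrier S" "polynomial us" "polynomial vs"
  shows "poly_val S \<sigma> (us @ vs) = plus S (poly_val S \<sigma> us) (poly_val S \<sigma> vs)"
  using assms(2)
proof (induction rule: polynomial_induct)
  case (single w)
  then show ?case using assms(3) by (simp add: poly_val_Cons polynomial_def)
next
  case (Cons w us)
  then have "us \<noteq> []" by (simp add: polynomial_def)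
  then show ?case using Cons assms poly_val_closed[OF assms(1)] word_val_closed[OF assms(1)]
    by (simp add: poly_val_Cons plus_assoc)
qed

lemma word_times_poly_val:
  assumes "range \<sigma> \<subseteq> carrier S" "w \<noteq> []" "polynomial vs"
  shows "poly_val S \<sigma> (map ((@) w) vs) = times S (word_val S \<sigma> w) (poly_val S \<sigma> vs)"
  using assms(3)
proof (induction rule: polynomial_induct)
  case (single v)
  then show ?case using assms by (simp add: word_val_append)
next
  case (Cons v vs)
  then have "vs \<noteq> []" by (simp add: polynomial_def)
  then show ?case using Cons assms poly_val_closed[OF assms(1)] word_val_closed[OF assms(1)]
    by (simp add: poly_val_Cons distrib_left word_val_append)
qed

lemma poly_val_times:
  assumes "range \<sigma> \<subseteq> carrier S" "polynomial us" "polynomial vs"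
  shows "poly_val S \<sigma> [w @ w'. w \<leftarrow> us, w' \<leftarrow> vs] = times S (poly_val S \<sigma> us) (poly_val S \<sigma> vs)"
  using assms(2)
proof (induction rule: polynomial_induct)
  case (single w)
  then show ?case using word_times_poly_val[OF assms(1) single assms(3)] by simp
next
  case (Cons w us)
  have "us \<noteq> []" "polynomial (map ((@) w) vs)"
    using Cons assms(3) by (auto simp: polynomial_def)
  then show ?case
    using Cons assms(3) poly_val_closed[OF assms(1)] word_val_closed[OF assms(1)]
      word_times_poly_val[OF assms(1) Cons(1) assms(3)] poly_val_append[OF assms(1)]
      polynomial_times[OF Cons(2) assms(3)]
    by (simp add: poly_val_Cons distrib_right)
qed

lemma poly_val_le_iff:
  assumes "range \<sigma> \<subseteq> carrier S" "z \<in> carrier S" "polynomial us"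
  shows "le S (poly_val S \<sigma> us) z \<longleftrightarrow> (\<forall>w\<in>set us. le S (word_val S \<sigma> w) z)"
  using assms(3)
proof (induction rule: polynomial_induct)
  case (Cons w us)
  then have "us \<noteq> []" by (simp add: polynomial_def)
  then show ?case
    using Cons assms poly_val_closed[OF assms(1)] word_val_closed[OF assms(1)]
    by (simp add: poly_val_Cons plus_le_iff)
qed simp

end

lemma prod_alg_poly_val:
  assumes "polynomial us" "i \<in> I"
  shows "poly_val (prod_alg I A) \<sigma> us i = poly_val (A i) (\<lambda>x. \<sigma> x i) us"
  using assms(1)
proof (induction rule: polynomial_induct)
  case (single w)
  then show ?case using assms(2) by (simp add: prod_alg_word_val)
next
  case (Cons w us)
  then have "us \<noteq> []" by (simp add: polynomial_def)
  then show ?case using Cons assms(2) prod_alg_word_val[OF Cons(1) assms(2), of A \<sigma>]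
    by (simp add: poly_val_Cons) (simp add: prod_alg_def)
qed

lemma ai_semiring_prod:
  fixes A :: "'i \<Rightarrow> 'a alg"
  assumes "\<And>i. i \<in> I \<Longrightarrow> ai_semiring (A i)"
  shows "ai_semiring (prod_alg I A)"
proof -
  have "subuniverse (carrier (prod_alg I A)) (prod_alg I A)"
    using assms
    by (auto simp: subuniverse_def prod_alg_def PiE_eq_empty_iff ai_semiring.nonempty
        intro!: ai_semiring.plus_closed ai_semiring.times_closed)
  moreover have "prod_alg I A \<in> Products (A ` I)" unfolding Products_def by blast
  ultimately have "ai_semiring ((prod_alg I A)\<lparr>carrier := carrier (prod_alg I A)\<rparr>)"
    using assms by (intro ai_semiring_subuniverse_prod[of "A ` I"]) auto
  then show ?thesis by simp
qed

text \<open>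
  Products may only be indexed by subsets of \<open>'u\<close>, and the factors will be indexed by
  inequalities. A list is coded by its length together with an iterated pairing; the length
  is required to make the iterated pairing injective.
\<close>

lemma infinite_imp_inj_lists:
  assumes "infinite (UNIV :: 'u set)"
  obtains e :: "'u list \<Rightarrow> 'u" where "inj e"
proof -
  obtain p :: "'u \<times> 'u \<Rightarrow> 'u" where p: "inj p"
    using card_of_Times_same_infinite[OF assms] unfolding card_of_ordIso[symmetric]
    by (auto simp: bij_betw_def)
  obtain c :: "nat \<Rightarrow> 'u" where c: "inj c"
    using assms infinite_countable_subset by blast
  define k where "k = foldr (\<lambda>x y. p (x, y)) "
  define e where "e xs = p (c (length xs), k xs (c 0))" for xs
  have k: "xs = ys" if "length xs = length ys" "k xs (c 0) = k ys (c 0)" for xs ys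
    using that by (induction xs ys rule: list_induct2) (auto simp: k_def dest: injD[OF p])
  have "inj e"
  proof (rule injI)
    fix xs ys assume "e xs = e ys"
    then have "c (length xs) = c (length ys)" "k xs (c 0) = k ys (c 0)"
      unfolding e_def by (auto dest: injD[OF p])
    then show "xs = ys" using k injD[OF c] by blast
  qed
  then show thesis using that by blast
qed

lemma not_satE:
  assumes "\<not> sat A u q"
  obtains \<sigma> z where "range \<sigma> \<subseteq> carrier A" "z \<in> carrier A"
    "\<forall>w\<in>u. le A (word_val A \<sigma> w) z" "\<not> le A (word_val A \<sigma> q) z"
  using assms by (auto simp: sat_def)

definition valid :: "'a alg set \<Rightarrow> 'v list set \<Rightarrow> 'v list \<Rightarrow> bool" where
  "valid K u q \<longleftrightarrow> (\<forall>A\<in>K. sat A u q)"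

text \<open>
  The hard half of Birkhoff's theorem. All assignments into all members of the variety are
  too many for an index set inside \<open>'u\<close>. One failing assignment for each inequality that is
  not valid in the variety suffices: it still separates the terms, and there are only as
  many inequalities as elements of \<open>'u\<close>. In the product of these members the elements of
  \<open>A\<close>, used as letters, generate a subalgebra in which two equal terms have equal values in
  \<open>A\<close>.
\<close>

theorem birkhoff:
  fixes A :: "'u alg"
  assumes inf: "infinite (UNIV :: 'u set)" and V: "variety \<V>" and A: "ai_semiring A"
    and sat: "\<And>u q :: 'u list. ineq u q \<Longrightarrow> valid \<V> u q \<Longrightarrow> sat A u q"
  shows "A \<in> \<V>"
proof -
  interpret A: ai_semiring A by fact
  obtain e1 :: "'u list \<Rightarrow> 'u" where e1: "inj e1" using infinite_imp_inj_lists[OF inf] .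
  define e :: "'u list list \<Rightarrow> 'u" where "e us = e1 (map e1 us)" for us
  have e: "us = vs" if "e us = e vs" for us vs
    using that injD[OF e1] inj_map_eq_map[OF e1] unfolding e_def by metis
  \<comment> \<open>An index is the code of an inequality that fails in the variety, with the left-hand side first.\<close>
  define I where "I = {e (q # us) |q us. ineq (set us) q \<and> \<not> valid \<V> (set us) q}"
  have "\<forall>i. \<exists>B \<sigma>. i \<in> I \<longrightarrow> B \<in> \<V> \<and> range \<sigma> \<subseteq> carrier B \<and> (\<exists>z\<in>carrier B. \<forall>q us. i = e (q # us) \<longrightarrow>
      (\<forall>w\<in>set us. le B (word_val B \<sigma> w) z) \<and> \<not> le B (word_val B \<sigma> q) z)"
  proof
    fix i
    show "\<exists>B \<sigma>. i \<in> I \<longrightarrow> B \<in> \<V> \<and> range \<sigma> \<subseteq> carrier B \<and> (\<exists>z\<in>carrier B. \<forall>q us. i = e (q # us) \<longrightarrow>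
      (\<forall>w\<in>set us. le B (word_val B \<sigma> w) z) \<and> \<not> le B (word_val B \<sigma> q) z)"
    proof (cases "i \<in> I")
      case True
      then obtain q us where i: "i = e (q # us)" and "\<not> valid \<V> (set us) q" unfolding I_def by blast
      then obtain B where B: "B \<in> \<V>" "\<not> sat B (set us) q" unfolding valid_def by blast
      obtain \<sigma> z where *: "range \<sigma> \<subseteq> carrier B" "z \<in> carrier B"
        "\<forall>w\<in>set us. le B (word_val B \<sigma> w) z" "\<not> le B (word_val B \<sigma> q) z"
        by (rule not_satE[OF B(2)])
      have "q' = q \<and> us' = us" if "i = e (q' # us')" for q' us' using e that i by blast
      then show ?thesis using B(1) * by (intro exI[of _ B] exI[of _ \<sigma>] impI conjI bexI[of _ z]) auto
    qed blast
  qed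
  then obtain B \<sigma> where B: "\<And>i. i \<in> I \<Longrightarrow> B i \<in> \<V>" and \<sigma>: "\<And>i. i \<in> I \<Longrightarrow> range (\<sigma> i) \<subseteq> carrier (B i)"
    and fails: "\<And>i. i \<in> I \<Longrightarrow> \<exists>z\<in>carrier (B i). \<forall>q us. i = e (q # us) \<longrightarrow>
      (\<forall>w\<in>set us. le (B i) (word_val (B i) (\<sigma> i) w) z) \<and> \<not> le (B i) (word_val (B i) (\<sigma> i) q) z"
    by metis
  have aiB: "ai_semiring (B i)" if "i \<in> I" for i using B[OF that] V unfolding variety_def by blast
  define P where "P = prod_alg I B"
  interpret P: ai_semiring P unfolding P_def using aiB by (rule ai_semiring_prod)
  define g where "g v = (\<lambda>i\<in>I. \<sigma> i v)" for v
  have g: "range g \<subseteq> carrier P" using \<sigma> by (auto simp: g_def P_def prod_alg_def image_subset_iff)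
  have comp: "poly_val P g us i = poly_val (B i) (\<sigma> i) us" if "polynomial us" "i \<in> I" for us i
    using that by (simp add: P_def prod_alg_poly_val g_def)
  obtain a0 where a0: "a0 \<in> carrier A" using A.nonempty by blast
  \<comment> \<open>Elements outside the carrier are letters too; they get an arbitrary value.\<close>
  define a where "a v = (if v \<in> carrier A then v else a0)" for v
  have a: "range a \<subseteq> carrier A" using a0 by (auto simp: a_def)
  \<comment> \<open>If a word of vs were not below us throughout the variety, the factor of that inequality would separate the two.\<close>
  have below: "le A (poly_val A a vs) (poly_val A a us)"
    if us: "polynomial us" and vs: "polynomial vs" and eq: "poly_val P g us = poly_val P g vs" for us vs
  proof -
    have "le A (word_val A a q) (poly_val A a us)" if q: "q \<in> set vs" for q
    proof -
      have w: "ineq (set us) q" using us vs q by (auto simp: polynomial_def ineq_def)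
      have "valid \<V> (set us) q"
      proof (rule ccontr)
        assume "\<not> valid \<V> (set us) q"
        then have i: "e (q # us) \<in> I" (is "?i \<in> I") using w unfolding I_def by blast
        then obtain z where z: "z \<in> carrier (B ?i)"
          "\<forall>w\<in>set us. le (B ?i) (word_val (B ?i) (\<sigma> ?i) w) z"
          "\<not> le (B ?i) (word_val (B ?i) (\<sigma> ?i) q) z"
          using fails[OF i] by blast
        note iff = ai_semiring.poly_val_le_iff[OF aiB[OF i] \<sigma>[OF i] z(1)]
        have "le (B ?i) (poly_val (B ?i) (\<sigma> ?i) us) z" using iff[OF us] z(2) by blast
        then have "le (B ?i) (poly_val (B ?i) (\<sigma> ?i) vs) z" using comp us vs eq i by metis
        then show False using iff[OF vs] z(3) q by blast
      qed
      then have "sat A (set us) q" using sat w by blast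
      then show ?thesis
        by (rule satD[OF _ a A.poly_val_closed[OF a us]])
          (use A.poly_val_le_iff[OF a A.poly_val_closed[OF a us] us] A.le_refl
            A.poly_val_closed[OF a us] in blast)
    qed
    then show ?thesis using A.poly_val_le_iff[OF a A.poly_val_closed[OF a us] vs] by blast
  qed
  define U where "U = poly_val P g ` {us. polynomial us}"
  define h where "h x = poly_val A a (SOME us. polynomial us \<and> x = poly_val P g us)" for x
  have h: "h (poly_val P g us) = poly_val A a us" if us: "polynomial us" for us
  proof -
    let ?vs = "SOME vs. polynomial vs \<and> poly_val P g us = poly_val P g vs"
    have "polynomial ?vs \<and> poly_val P g us = poly_val P g ?vs" by (rule someI[of _ us]) (simp add: us)
    then have "poly_val A a ?vs = poly_val A a us"
      using below[of us ?vs] below[of ?vs us] us A.poly_val_closed[OF a]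
      by (intro A.le_antisym) auto
    then show ?thesis by (simp add: h_def)
  qed
  have "subuniverse U P" unfolding subuniverse_def
  proof (intro conjI ballI)
    show "U \<noteq> {}" unfolding U_def by (auto simp: polynomial_def intro!: exI[of _ "[[undefined]]"])
    show "U \<subseteq> carrier P" unfolding U_def using P.poly_val_closed[OF g] by blast
    fix x y assume "x \<in> U" "y \<in> U"
    then obtain us vs where "polynomial us" "polynomial vs" "x = poly_val P g us" "y = poly_val P g vs"
      unfolding U_def by blast
    then show "plus P x y \<in> U" "times P x y \<in> U"
      unfolding U_def
      using P.poly_val_append[OF g, of us vs] P.poly_val_times[OF g, of us vs]
        polynomial_append[of us vs] polynomial_times[of us vs]
      by (metis image_eqI mem_Collect_eq)+
  qed
  moreover have "P \<in> Products \<V>" unfolding Products_def P_def using B by blast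
  moreover have "h \<in> hom (P\<lparr>carrier := U\<rparr>) A"
  proof -
    have "h x \<in> carrier A" if "x \<in> U" for x
      using that h A.poly_val_closed[OF a] unfolding U_def by auto
    moreover have "h (plus P x y) = plus A (h x) (h y) \<and> h (times P x y) = times A (h x) (h y)"
      if "x \<in> U" "y \<in> U" for x y
    proof -
      obtain us vs where uv: "polynomial us" "polynomial vs"
        and [simp]: "x = poly_val P g us" "y = poly_val P g vs"
        using \<open>x \<in> U\<close> \<open>y \<in> U\<close> unfolding U_def by blast
      show ?thesis
        using h[OF polynomial_append[OF uv]] h[OF polynomial_times[OF uv]] h[OF uv(1)] h[OF uv(2)]
        by (simp add: P.poly_val_append[OF g uv] P.poly_val_times[OF g uv]
            A.poly_val_append[OF a uv] A.poly_val_times[OF a uv])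
    qed
    ultimately show ?thesis by (auto simp: hom_def)
  qed
  moreover have "h ` carrier (P\<lparr>carrier := U\<rparr>) = carrier A"
  proof
    show "h ` carrier (P\<lparr>carrier := U\<rparr>) \<subseteq> carrier A"
      using \<open>h \<in> hom (P\<lparr>carrier := U\<rparr>) A\<close> unfolding hom_def by blast
    show "carrier A \<subseteq> h ` carrier (P\<lparr>carrier := U\<rparr>)"
    proof
      fix c assume c: "c \<in> carrier A"
      have p: "polynomial [[c]]" by (simp add: polynomial_def)
      have "h (poly_val P g [[c]]) = c" using h[OF p] c by (simp add: a_def)
      moreover have "poly_val P g [[c]] \<in> U" unfolding U_def using p by blast
      ultimately show "c \<in> h ` carrier (P\<lparr>carrier := U\<rparr>)" by force
    qed
  qed
  ultimately have "P\<lparr>carrier := U\<rparr> \<in> Subalgebras (Products \<V>)"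
    and "h \<in> hom (P\<lparr>carrier := U\<rparr>) A" "h ` carrier (P\<lparr>carrier := U\<rparr>) = carrier A"
    unfolding Subalgebras_def by blast+
  then have "A \<in> Hom_images (Subalgebras (Products \<V> :: ('u \<Rightarrow> 'u) alg set))"
    unfolding Hom_images_def by blast
  then show ?thesis using V unfolding variety_def by blast
qed

lemma variety_subsetI:
  fixes \<V> \<W> :: "'u alg set"
  assumes "infinite (UNIV :: 'u set)" "variety \<V>" "variety \<W>"
    and "\<And>u q :: 'u list. ineq u q \<Longrightarrow> valid \<W> u q \<Longrightarrow> valid \<V> u q"
  shows "\<V> \<subseteq> \<W>"
proof
  fix A assume "A \<in> \<V>"
  then show "A \<in> \<W>"
    using assms by (intro birkhoff) (auto simp: variety_def valid_def)
qed

lemma copies_exists: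
  assumes "infinite (UNIV :: 'u set)" "finite (carrier S)"
  obtains C :: "'u alg" where "C \<in> copies S"
proof -
  obtain f :: "'a \<Rightarrow> 'u" where f: "inj_on f (carrier S)"
  proof -
    obtain k :: "'a \<Rightarrow> nat" where k: "inj_on k (carrier S)"
      using finite_imp_inj_to_nat_seg[OF assms(2)] by blast
    obtain c :: "nat \<Rightarrow> 'u" where "inj c" using infinite_countable_subset[OF assms(1)] by blast
    then have "inj_on (c \<circ> k) (carrier S)" using k by (simp add: comp_inj_on inj_on_subset)
    then show thesis using that by blast
  qed
  define g where "g = inv_into (carrier S) f"
  let ?C = "\<lparr>carrier = f ` carrier S, plus = \<lambda>x y. f (plus S (g x) (g y)),
    times = \<lambda>x y. f (times S (g x) (g y))\<rparr>"
  have "g (f x) = x" if "x \<in> carrier S" for x using that f unfolding g_def by simp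
  then have "f \<in> hom S ?C" by (auto simp: hom_def)
  moreover have "bij_betw f (carrier S) (carrier ?C)" using f by (simp add: bij_betw_def)
  ultimately show thesis using that[of ?C] unfolding copies_def by blast
qed

lemma sat_copies:
  "\<lbrakk>C \<in> copies S; ai_semiring S; ineq u q\<rbrakk> \<Longrightarrow> sat C u q \<longleftrightarrow> sat S u q"
  unfolding copies_def using sat_iso by blast

lemma valid_copies:
  assumes "infinite (UNIV :: 'u set)" "ai_semiring S" "finite (carrier S)" "ineq u q"
  shows "valid (copies S :: 'u alg set) u q \<longleftrightarrow> sat S u q"
proof -
  obtain C :: "'u alg" where "C \<in> copies S" using copies_exists[OF assms(1,3)] .
  then show ?thesis using sat_copies[OF _ assms(2,4)] unfolding valid_def by blast
qed

lemma valid_Var: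
  assumes "K \<subseteq> {A. ai_semiring A}" "ineq u q"
  shows "valid (Var K) u q \<longleftrightarrow> valid K u q"
proof -
  have "K \<subseteq> Var K" unfolding Var_def by blast
  then show ?thesis using sat_Var[of _ K u q] assms unfolding valid_def by blast
qed

lemma valid_Un: "valid (K \<union> K') u q \<longleftrightarrow> valid K u q \<and> valid K' u q"
  unfolding valid_def by blast

section \<open>Adjoining a zero\<close>

text \<open>
  The words that survive when all letters foreign to \<open>q\<close> are set to zero.
\<close>

definition within :: "'v list set \<Rightarrow> 'v list \<Rightarrow> 'v list set" where
  "within u q = {w \<in> u. set w \<subseteq> set q}"

lemma ineq_within: "ineq u q \<Longrightarrow> within u q \<noteq> {} \<Longrightarrow> ineq (within u q) q"
  by (auto simp: ineq_def within_def)

lemma within_eq: "letters u \<subseteq> set q \<Longrightarrow> within u q = u"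
  by (auto simp: letters_def within_def)

lemma letters_within: "letters (within u q) \<subseteq> set q"
  by (auto simp: letters_def within_def)

lemma le_adjoin_zero [simp]:
  "le (adjoin_zero S) None x"
  "le (adjoin_zero S) (Some s) None \<longleftrightarrow> False"
  "le (adjoin_zero S) (Some s) (Some t) \<longleftrightarrow> le S s t"
  by (auto simp: le_def adjoin_zero_def split: option.splits)

lemma times_adjoin_zero [simp]:
  "times (adjoin_zero S) None x = None"
  "times (adjoin_zero S) x None = None"
  "times (adjoin_zero S) (Some s) (Some t) = Some (times S s t)"
  by (auto simp: adjoin_zero_def split: option.splits)

lemma carrier_adjoin_zero: "carrier (adjoin_zero S) = insert None (Some ` carrier S)"
  by (simp add: adjoin_zero_def)

lemma word_val_adjoin_zero_None:
  "x \<in> set w \<Longrightarrow> \<sigma> x = None \<Longrightarrow> word_val (adjoin_zero S) \<sigma> w = None"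
proof (induction w)
  case (Cons y w)
  then show ?case by (cases "w = []") (auto simp: word_val_Cons)
qed simp

lemma word_val_adjoin_zero_Some:
  "w \<noteq> [] \<Longrightarrow> (\<And>x. x \<in> set w \<Longrightarrow> \<sigma> x = Some (\<tau> x))
    \<Longrightarrow> word_val (adjoin_zero S) \<sigma> w = Some (word_val S \<tau> w)"
proof (induction w)
  case (Cons y w)
  then show ?case by (cases "w = []") (auto simp: word_val_Cons)
qed simp

text \<open>
  From left to right, set the letters foreign to \<open>q\<close> to zero: the deleted words become zero,
  and if none were left then zero would be an upper bound. From right to left, if some
  letter of \<open>q\<close> is zero, so is \<open>q\<close>; otherwise the surviving words are evaluated in \<open>S\<close>, and
  they force the upper bound into \<open>S\<close>.
\<close>

lemma sat_adjoin_zero: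
  assumes S: "ai_semiring S" and u: "ineq u q"
  shows "sat (adjoin_zero S) u q \<longleftrightarrow> within u q \<noteq> {} \<and> sat S (within u q) q"
proof (intro iffI conjI)
  interpret ai_semiring S by fact
  obtain a0 where a0: "a0 \<in> carrier S" using nonempty by blast
  have q: "q \<noteq> []" and ne: "w \<noteq> []" if "w \<in> u" for w using u that by (auto simp: ineq_def)
  have q: "q \<noteq> []" using u by (auto simp: ineq_def)
  {
    fix \<sigma> :: "'b \<Rightarrow> 'a" and z
    assume sat: "sat (adjoin_zero S) u q" and \<sigma>: "range \<sigma> \<subseteq> carrier S" and z: "z = None \<or> z \<in> Some ` carrier S"
      and ub: "\<And>w. w \<in> within u q \<Longrightarrow> le (adjoin_zero S) (Some (word_val S \<sigma> w)) z"
    define \<sigma>' where "\<sigma>' x = (if x \<in> set q then Some (\<sigma> x) else None)" for x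
    have "le (adjoin_zero S) (word_val (adjoin_zero S) \<sigma>' q) z"
    proof (rule satD[OF sat])
      show "range \<sigma>' \<subseteq> carrier (adjoin_zero S)" "z \<in> carrier (adjoin_zero S)"
        using \<sigma> z by (auto simp: carrier_adjoin_zero \<sigma>'_def)
      fix w assume w: "w \<in> u"
      show "le (adjoin_zero S) (word_val (adjoin_zero S) \<sigma>' w) z"
      proof (cases "set w \<subseteq> set q")
        case True
        then have "word_val (adjoin_zero S) \<sigma>' w = Some (word_val S \<sigma> w)"
          by (intro word_val_adjoin_zero_Some ne w) (auto simp: \<sigma>'_def)
        then show ?thesis using ub w True by (auto simp: within_def)
      next
        case False
        then obtain x where "x \<in> set w" "x \<notin> set q" by blast
        then show ?thesis using word_val_adjoin_zero_None[of x w \<sigma>' S] by (simp add: \<sigma>'_def)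
      qed
    qed
    moreover have "word_val (adjoin_zero S) \<sigma>' q = Some (word_val S \<sigma> q)"
      by (intro word_val_adjoin_zero_Some q) (auto simp: \<sigma>'_def)
    ultimately have "le (adjoin_zero S) (Some (word_val S \<sigma> q)) z" by simp
  } note main = this
  show "within u q \<noteq> {}" if "sat (adjoin_zero S) u q"
    using main[OF that, of "\<lambda>x. a0" None] a0 by auto
  show "sat S (within u q) q" if "sat (adjoin_zero S) u q"
    using main[OF that, of _ "Some z" for z] by (intro satI) auto
  assume *: "within u q \<noteq> {} \<and> sat S (within u q) q"
  show "sat (adjoin_zero S) u q"
  proof (rule satI)
    fix \<sigma> z
    assume \<sigma>: "range \<sigma> \<subseteq> carrier (adjoin_zero S)" and z: "z \<in> carrier (adjoin_zero S)"
      and ub: "\<And>w. w \<in> u \<Longrightarrow> le (adjoin_zero S) (word_val (adjoin_zero S) \<sigma> w) z"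
    show "le (adjoin_zero S) (word_val (adjoin_zero S) \<sigma> q) z"
    proof (cases "\<exists>x\<in>set q. \<sigma> x = None")
      case True
      then show ?thesis using word_val_adjoin_zero_None[of _ q \<sigma> S] by auto
    next
      case False
      define \<tau> where "\<tau> x = (case \<sigma> x of Some s \<Rightarrow> s | None \<Rightarrow> a0)" for x
      have \<tau>: "range \<tau> \<subseteq> carrier S"
      proof
        fix y assume "y \<in> range \<tau>"
        then obtain x where "y = \<tau> x" by blast
        moreover have "\<sigma> x \<in> carrier (adjoin_zero S)" using \<sigma> by blast
        ultimately show "y \<in> carrier S" using a0 by (auto simp: \<tau>_def carrier_adjoin_zero)
      qed
      have val: "word_val (adjoin_zero S) \<sigma> w = Some (word_val S \<tau> w)" if w: "w \<noteq> []" "set w \<subseteq> set q" for w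
      proof (rule word_val_adjoin_zero_Some[OF w(1)])
        fix x assume "x \<in> set w"
        then obtain s where "\<sigma> x = Some s" using False w(2) by fastforce
        then show "\<sigma> x = Some (\<tau> x)" by (simp add: \<tau>_def)
      qed
      obtain w where w: "w \<in> within u q" using * by blast
      then obtain z' where z': "z = Some z'" "z' \<in> carrier S"
        using ub[of w] val[of w] ne[of w] z by (cases z) (auto simp: within_def carrier_adjoin_zero)
      have "le S (word_val S \<tau> q) z'"
      proof (rule satD[OF _ \<tau> z'(2)])
        show "sat S (within u q) q" using * by blast
        show "le S (word_val S \<tau> w) z'" if "w \<in> within u q" for w
          using that ub[of w] val[of w] ne[of w] z'(1) by (auto simp: within_def)
      qed
      then show ?thesis using val[OF q] z'(1) by simp
    qed
  qed
qed

section \<open>The inequalities of the generating semirings\<close>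

lemma carrier_M2 [simp]: "carrier M2 = {0, 1}"
  by (simp add: M2_def)

lemma carrier_S7 [simp]: "carrier S7 = UNIV"
  by (simp add: S7_def)

lemma le_M2 [simp]: "le M2 x y \<longleftrightarrow> x \<le> y"
  by (auto simp: le_def M2_def)

lemma word_val_M2: "w \<noteq> [] \<Longrightarrow> word_val M2 \<sigma> w = 0 \<longleftrightarrow> (\<forall>x\<in>set w. \<sigma> x = 0)"
proof (induction w)
  case (Cons y w)
  then show ?case by (cases "w = []") (auto simp: word_val_Cons M2_def)
qed simp

text \<open>
  In \<open>M\<^sub>2\<close> a word is the maximum of its letters, and \<open>0\<close> is a bound exactly if all letters
  of \<open>u\<close> are \<open>0\<close>.
\<close>

lemma sat_M2:
  assumes "ineq u q"
  shows "sat M2 u q \<longleftrightarrow> set q \<subseteq> letters u"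
proof
  have ne: "q \<noteq> []" "\<And>w. w \<in> u \<Longrightarrow> w \<noteq> []" using assms by (auto simp: ineq_def)
  assume sat: "sat M2 u q"
  let ?\<sigma> = "\<lambda>x. if x \<in> letters u then 0 else 1 :: nat"
  have "word_val M2 ?\<sigma> w = 0" if "w \<in> u" for w
    using that word_val_M2[OF ne(2)[OF that], of ?\<sigma>] by (auto simp: letters_def)
  then have "le M2 (word_val M2 ?\<sigma> q) 0"
    by (intro satD[OF sat]) auto
  then show "set q \<subseteq> letters u"
    using word_val_M2[OF ne(1), of ?\<sigma>] by (auto split: if_splits)
next
  have ne: "q \<noteq> []" "\<And>w. w \<in> u \<Longrightarrow> w \<noteq> []" using assms by (auto simp: ineq_def)
  assume sub: "set q \<subseteq> letters u"
  show "sat M2 u q"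
  proof (rule satI)
    fix \<sigma> :: "'a \<Rightarrow> nat" and z
    assume \<sigma>: "range \<sigma> \<subseteq> carrier M2" and z: "z \<in> carrier M2"
      and ub: "\<And>w. w \<in> u \<Longrightarrow> le M2 (word_val M2 \<sigma> w) z"
    show "le M2 (word_val M2 \<sigma> q) z"
    proof (cases "z = 0")
      case True
      then have "\<forall>w\<in>u. \<forall>x\<in>set w. \<sigma> x = 0" using ub word_val_M2 ne by (metis le_M2 le_zero_eq)
      then have "\<forall>x\<in>set q. \<sigma> x = 0" using sub by (auto simp: letters_def)
      then show ?thesis using word_val_M2[OF ne(1), of \<sigma>] by simp
    next
      case False
      have "word_val M2 \<sigma> q \<in> carrier M2"
        using ai_semiring.word_val_closed[OF ai_semiring_M2 \<sigma> ne(1)] .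
      then show ?thesis using False z by auto
    qed
  qed
qed

lemma le_S7 [simp]: "le S7 x y \<longleftrightarrow> x = y \<or> y = S7_inf"
  by (auto simp: le_def S7_def)

lemma word_val_S7_one: "w \<noteq> [] \<Longrightarrow> word_val S7 \<sigma> w = S7_one \<longleftrightarrow> (\<forall>x\<in>set w. \<sigma> x = S7_one)"
proof (induction w)
  case (Cons y w)
  then show ?case by (cases "w = []") (auto simp: word_val_Cons S7_def)
qed simp

text \<open>
  The letter \<open>a\<close> may occur only once, since \<open>a \<cdot> a = \<infinity>\<close>. This counting of occurrences is
  what relates \<open>S\<^sub>7\<close> to the semirings of subsets below.
\<close>

lemma word_val_S7_a:
  "w \<noteq> [] \<Longrightarrow> word_val S7 \<sigma> w = S7_a \<longleftrightarrow>
    (\<forall>x\<in>set w. \<sigma> x \<noteq> S7_inf) \<and> length (filter (\<lambda>x. \<sigma> x = S7_a) w) = 1"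
proof (induction w)
  case (Cons y w)
  show ?case
  proof (cases "w = []")
    case False
    have one: "(\<forall>x\<in>set w. \<sigma> x \<noteq> S7_inf) \<and> filter (\<lambda>x. \<sigma> x = S7_a) w = []
        \<longleftrightarrow> word_val S7 \<sigma> w = S7_one"
      using word_val_S7_one[OF False, of \<sigma>] by (auto simp: filter_empty_conv) (metis s7.exhaust)
    show ?thesis
      using Cons.IH[OF False] one False
      by (cases "\<sigma> y") (auto simp: word_val_Cons S7_def)
  qed auto
qed simp

lemma sat_S7I:
  assumes "\<And>\<sigma>. (\<And>w. w \<in> u \<Longrightarrow> word_val S7 \<sigma> w = S7_one) \<Longrightarrow> word_val S7 \<sigma> q = S7_one"
    and "\<And>\<sigma>. (\<And>w. w \<in> u \<Longrightarrow> word_val S7 \<sigma> w = S7_a) \<Longrightarrow> word_val S7 \<sigma> q = S7_a"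
  shows "sat S7 u q"
proof (rule satI)
  fix \<sigma> z assume "\<And>w. w \<in> u \<Longrightarrow> le S7 (word_val S7 \<sigma> w) z"
  then show "le S7 (word_val S7 \<sigma> q) z" using assms[of \<sigma>] by (cases z) auto
qed

lemma sat_S7D:
  "\<lbrakk>sat S7 u q; z \<noteq> S7_inf; \<And>w. w \<in> u \<Longrightarrow> word_val S7 \<sigma> w = z\<rbrakk> \<Longrightarrow> word_val S7 \<sigma> q = z"
  using satD[of S7 u q \<sigma> z] by auto

lemma word_val_S7_one_letters:
  assumes "ineq u q" "set q \<subseteq> letters u" "\<And>w. w \<in> u \<Longrightarrow> word_val S7 \<sigma> w = S7_one"
  shows "word_val S7 \<sigma> q = S7_one"
proof -
  have "\<sigma> x = S7_one" if "w \<in> u" "x \<in> set w" for w x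
    using assms(1) assms(3)[OF that(1)] that word_val_S7_one[of w \<sigma>] by (auto simp: ineq_def)
  then show ?thesis using assms(1,2) word_val_S7_one[of q \<sigma>] by (auto simp: ineq_def letters_def)
qed

lemma sat_S7_perm:
  assumes "mset w = mset w'" "w \<noteq> []"
  shows "sat S7 {w} w'"
proof -
  have "w' \<noteq> []" "set w' = set w" using assms by (auto dest: mset_eq_setD)
  moreover have "length (filter P w') = length (filter P w)" for P
    using assms(1) by (metis mset_filter size_mset)
  ultimately show ?thesis
    using assms(2) by (intro sat_S7I) (auto simp: word_val_S7_one word_val_S7_a)
qed

text \<open>
  Doubled words have only the values \<open>1\<close> and \<open>\<infinity>\<close> in \<open>S\<^sub>7\<close>.
\<close>

definition doubled :: "'v list \<Rightarrow> bool" where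
  "doubled w \<longleftrightarrow> (\<forall>x\<in>set w. 2 \<le> count (mset w) x)"

lemma doubled_append_self: "doubled (w @ w)"
proof -
  have "2 \<le> count (mset w) x + count (mset w) x" if "x \<in> set w" for x
  proof -
    have "0 < count (mset w) x" using that by simp
    then show ?thesis by linarith
  qed
  then show ?thesis by (auto simp: doubled_def)
qed

lemma doubled_val_S7:
  assumes "doubled w" "w \<noteq> []"
  shows "word_val S7 \<sigma> w \<noteq> S7_a"
proof
  assume "word_val S7 \<sigma> w = S7_a"
  then have "length (filter (\<lambda>x. \<sigma> x = S7_a) w) = 1" using assms(2) by (simp add: word_val_S7_a)
  then obtain x where x: "filter (\<lambda>x. \<sigma> x = S7_a) w = [x]" by (auto simp: length_Suc_conv)
  then have "x \<in> set (filter (\<lambda>x. \<sigma> x = S7_a) w)" by simp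
  then have "x \<in> set w" "\<sigma> x = S7_a" by auto
  then have "count (mset (filter (\<lambda>x. \<sigma> x = S7_a) w)) x = count (mset w) x"
    by (simp only: mset_filter) simp
  then show False using x assms(1) \<open>x \<in> set w\<close> by (auto simp: doubled_def)
qed

text \<open>
  The only finite bound left is \<open>1\<close>, which requires all letters of \<open>u\<close> to be \<open>1\<close>.
\<close>

lemma sat_S7_never_a:
  assumes "ineq u q" "set q \<subseteq> letters u" "\<And>\<sigma>. \<exists>w\<in>u. word_val S7 \<sigma> w \<noteq> S7_a"
  shows "sat S7 u q"
proof (rule sat_S7I)
  fix \<sigma> assume "\<And>w. w \<in> u \<Longrightarrow> word_val S7 \<sigma> w = S7_one"
  then show "word_val S7 \<sigma> q = S7_one" by (rule word_val_S7_one_letters[OF assms(1,2)])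
next
  fix \<sigma> assume "\<And>w. w \<in> u \<Longrightarrow> word_val S7 \<sigma> w = S7_a"
  then show "word_val S7 \<sigma> q = S7_a" using assms(3)[of \<sigma>] by metis
qed

lemma sat_S7_doubled:
  assumes "ineq u q" "set q \<subseteq> letters u" "w \<in> u" "doubled w"
  shows "sat S7 u q"
  using assms doubled_val_S7[of w] by (intro sat_S7_never_a) (auto simp: ineq_def)

subsection \<open>Flat nil semirings of subsets\<close>

text \<open>
  The semiring \<open>S\<^sub>c(a\<^sub>0\<dots>a\<^sub>n\<^sub>-\<^sub>1)\<close>: a nonempty set of indices stands for the product of the
  corresponding letters, and \<open>None\<close> is \<open>\<infinity>\<close>.
\<close>

definition Sc_gen :: "nat \<Rightarrow> nat set option alg" where
  "Sc_gen n = \<lparr>carrier = insert None (Some ` {s. s \<noteq> {} \<and> s \<subseteq> {..<n}}),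
     plus = (\<lambda>x y. if x = y then x else None),
     times = (\<lambda>x y. case (x, y) of
       (Some s, Some t) \<Rightarrow> if s \<inter> t = {} then Some (s \<union> t) else None | _ \<Rightarrow> None)\<rparr>"

lemma ai_semiring_Sc_gen: "ai_semiring (Sc_gen n)"
proof
  fix x y z
  show "times (Sc_gen n) x (plus (Sc_gen n) y z) = plus (Sc_gen n) (times (Sc_gen n) x y) (times (Sc_gen n) x z)"
    by (auto simp: Sc_gen_def split: option.splits)
  show "times (Sc_gen n) (plus (Sc_gen n) x y) z = plus (Sc_gen n) (times (Sc_gen n) x z) (times (Sc_gen n) y z)"
    by (auto simp: Sc_gen_def split: option.splits)
  show "times (Sc_gen n) (times (Sc_gen n) x y) z = times (Sc_gen n) x (times (Sc_gen n) y z)"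
    by (auto simp: Sc_gen_def split: option.splits)
next
  show "carrier (Sc_gen n) \<noteq> {}" by (simp add: Sc_gen_def)
  fix x y z
  show "plus (Sc_gen n) (plus (Sc_gen n) x y) z = plus (Sc_gen n) x (plus (Sc_gen n) y z)"
    "plus (Sc_gen n) x y = plus (Sc_gen n) y x" "plus (Sc_gen n) x x = x"
    by (simp_all add: Sc_gen_def)
  assume "x \<in> carrier (Sc_gen n)" "y \<in> carrier (Sc_gen n)"
  then show "plus (Sc_gen n) x y \<in> carrier (Sc_gen n)" "times (Sc_gen n) x y \<in> carrier (Sc_gen n)"
    by (cases x; cases y; simp add: Sc_gen_def image_iff; blast)+
qed

lemma finite_carrier_Sc_gen: "finite (carrier (Sc_gen n))"
proof -
  have "{s. s \<noteq> {} \<and> s \<subseteq> {..<n}} \<subseteq> Pow {..<n}" by blast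
  then show ?thesis by (auto simp: Sc_gen_def intro: finite_subset)
qed

lemma le_Sc_gen [simp]: "le (Sc_gen n) x y \<longleftrightarrow> x = y \<or> y = None"
  by (auto simp: le_def Sc_gen_def)

lemma times_Sc_gen_eq_Some:
  "times (Sc_gen n) x y = Some s \<longleftrightarrow> (\<exists>t r. x = Some t \<and> y = Some r \<and> t \<inter> r = {} \<and> s = t \<union> r)"
  by (auto simp: Sc_gen_def split: option.splits if_splits)

lemma word_val_Sc_gen_Cons:
  "w \<noteq> [] \<Longrightarrow> word_val (Sc_gen n) \<sigma> (x # w) = Some s \<longleftrightarrow>
    (\<exists>t r. \<sigma> x = Some t \<and> word_val (Sc_gen n) \<sigma> w = Some r \<and> t \<inter> r = {} \<and> s = t \<union> r)"
  by (simp add: word_val_Cons times_Sc_gen_eq_Some)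

lemma sat_Sc_genI:
  assumes "\<And>\<sigma> s. range \<sigma> \<subseteq> carrier (Sc_gen n) \<Longrightarrow>
    (\<And>w. w \<in> u \<Longrightarrow> word_val (Sc_gen n) \<sigma> w = Some s) \<Longrightarrow> word_val (Sc_gen n) \<sigma> q = Some s"
  shows "sat (Sc_gen n) u q"
proof (rule satI)
  fix \<sigma> z assume "range \<sigma> \<subseteq> carrier (Sc_gen n)" "\<And>w. w \<in> u \<Longrightarrow> le (Sc_gen n) (word_val (Sc_gen n) \<sigma> w) z"
  then show "le (Sc_gen n) (word_val (Sc_gen n) \<sigma> q) z" using assms[of \<sigma>] by (cases z) auto
qed

lemma sat_Sc_genD:
  assumes "sat (Sc_gen n) u q" "range \<sigma> \<subseteq> carrier (Sc_gen n)" "ineq u q"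
    "\<And>w. w \<in> u \<Longrightarrow> word_val (Sc_gen n) \<sigma> w = Some s"
  shows "word_val (Sc_gen n) \<sigma> q = Some s"
proof -
  interpret ai_semiring "Sc_gen n" by (rule ai_semiring_Sc_gen)
  obtain w where "w \<in> u" "w \<noteq> []" using assms(3) by (auto simp: ineq_def)
  then have "Some s \<in> carrier (Sc_gen n)" using word_val_closed[OF assms(2)] assms(4) by metis
  then show ?thesis using satD[OF assms(1,2)] assms(4) by fastforce
qed

lemma not_sat_Sc_genE:
  assumes "\<not> sat (Sc_gen n) u q"
  obtains \<sigma> s where "range \<sigma> \<subseteq> carrier (Sc_gen n)"
    "\<And>w. w \<in> u \<Longrightarrow> word_val (Sc_gen n) \<sigma> w = Some s" "word_val (Sc_gen n) \<sigma> q \<noteq> Some s"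
  using assms sat_Sc_genI by metis

text \<open>
  The factors of an element as a word over \<open>{..<n}\<close>. For \<open>\<infinity>\<close> it is the square of the full
  word, whose repeated letters can never form a set; thus substituting these words records
  the value of a word of \<open>Sc_gen n\<close> faithfully, see \<open>word_val_Sc_gen_iff\<close>.
\<close>

definition subset_word :: "nat \<Rightarrow> nat set option \<Rightarrow> nat list" where
  "subset_word n x = (case x of Some s \<Rightarrow> sorted_list_of_set s | None \<Rightarrow> [0..<n] @ [0..<n])"

lemma mset_sorted_list_of_set [simp]: "mset (sorted_list_of_set s) = mset_set s"
  by (metis mset_sorted_list_of_multiset sorted_list_of_mset_set)

lemma word_val_Sc_gen_iff:
  assumes "range \<sigma> \<subseteq> carrier (Sc_gen n)" "n > 0" "w \<noteq> []" "finite s"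
  shows "word_val (Sc_gen n) \<sigma> w = Some s \<longleftrightarrow> mset (subst (\<lambda>x. subset_word n (\<sigma> x)) w) = mset_set s"
  using assms(3,4)
proof (induction w arbitrary: s)
  case (Cons x w)
  have \<sigma>x: "\<sigma> x \<in> carrier (Sc_gen n)" using assms(1) by blast
  have fin: "finite t" if "\<sigma> x = Some t" for t
    using \<sigma>x that by (auto simp: Sc_gen_def intro: finite_subset)
  have not_None: "\<sigma> x \<noteq> None" if "mset (subset_word n (\<sigma> x)) + M = mset_set s" for M
  proof
    assume "\<sigma> x = None"
    then have "count (mset (subset_word n (\<sigma> x))) 0 = 2"
      using assms(2) by (simp add: subset_word_def count_mset_set')
    then have "count (mset_set s) 0 \<ge> 2" using that[symmetric] by simp
    then show False by (simp add: count_mset_set' split: if_splits)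
  qed
  have single: "\<sigma> x = Some t \<longleftrightarrow> mset (subset_word n (\<sigma> x)) = mset_set t" if "finite t" for t
  proof (cases "\<sigma> x")
    case None
    then have "count (mset (subset_word n (\<sigma> x))) 0 = 2" "count (mset_set t) 0 \<le> 1"
      using assms(2) by (simp_all add: subset_word_def count_mset_set')
    then show ?thesis using None by auto
  next
    case (Some r)
    then show ?thesis using fin[OF Some] that by (auto simp: subset_word_def mset_set_eq_iff)
  qed
  show ?case
  proof (cases "w = []")
    case True
    then show ?thesis using single[OF Cons.prems(2)] by simp
  next
    case False
    show ?thesis
    proof
      assume "word_val (Sc_gen n) \<sigma> (x # w) = Some s"
      then obtain t r where tr: "\<sigma> x = Some t" "word_val (Sc_gen n) \<sigma> w = Some r" "t \<inter> r = {}" "s = t \<union> r"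
        using word_val_Sc_gen_Cons[OF False] by blast
      then have "finite r" "finite t" using Cons.prems by auto
      then show "mset (subst (\<lambda>x. subset_word n (\<sigma> x)) (x # w)) = mset_set s"
        using Cons.IH[OF False, of r] tr by (simp add: subset_word_def mset_set_Union)
    next
      assume eq: "mset (subst (\<lambda>x. subset_word n (\<sigma> x)) (x # w)) = mset_set s"
      then obtain t where t: "\<sigma> x = Some t" using not_None by auto
      let ?M = "mset (subst (\<lambda>x. subset_word n (\<sigma> x)) w)"
      have eq': "mset_set t + ?M = mset_set s"
        using eq t fin[OF t] by (simp add: subset_word_def)
      then have sub: "t \<subseteq> s" using fin[OF t] Cons.prems(2)
        by (metis finite_set_mset_mset_set mset_subset_eq_add_left set_mset_mono)
      then have "mset_set s = mset_set t + mset_set (s - t)"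
        using mset_set_Union[of t "s - t"] Cons.prems(2) fin[OF t] by (simp add: Un_absorb1)
      then have "?M = mset_set (s - t)" using eq' by simp
      then have "word_val (Sc_gen n) \<sigma> w = Some (s - t)"
        using Cons.IH[OF False, of "s - t"] Cons.prems(2) by simp
      then show "word_val (Sc_gen n) \<sigma> (x # w) = Some s"
        using t sub word_val_Sc_gen_Cons[OF False, of n \<sigma> x s] by blast
    qed
  qed
qed simp

lemma card_word_val_Sc_gen:
  assumes "range \<sigma> \<subseteq> carrier (Sc_gen n)" "w \<noteq> []" "word_val (Sc_gen n) \<sigma> w = Some s"
  shows "s \<subseteq> {..<n} \<and> length w \<le> card s"
  using assms(2,3)
proof (induction w arbitrary: s)
  case (Cons x w)
  have \<sigma>x: "t \<noteq> {} \<and> t \<subseteq> {..<n}" if "\<sigma> x = Some t" for t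
  proof -
    have "Some t \<in> carrier (Sc_gen n)" using assms(1) that by (metis rangeI subsetD)
    then show ?thesis by (auto simp: Sc_gen_def)
  qed
  have card: "1 \<le> card t" if "\<sigma> x = Some t" for t
    using \<sigma>x[OF that] by (metis card_gt_0_iff finite_lessThan finite_subset One_nat_def Suc_leI)
  show ?case
  proof (cases "w = []")
    case True
    then show ?thesis using Cons.prems \<sigma>x card by simp
  next
    case False
    then obtain t r where tr: "\<sigma> x = Some t" "word_val (Sc_gen n) \<sigma> w = Some r" "t \<inter> r = {}" "s = t \<union> r"
      using word_val_Sc_gen_Cons[OF False] Cons.prems by blast
    then have "card s = card t + card r"
      using Cons.IH[OF False tr(2)] \<sigma>x[OF tr(1)] by (metis card_Un_disjoint finite_lessThan finite_subset)
    then show ?thesis using Cons.IH[OF False tr(2)] \<sigma>x[OF tr(1)] card[OF tr(1)] tr(4) by simp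
  qed
qed simp

text \<open>
  This puts \<open>Sc_gen n\<close> into \<open>V(S\<^sub>7)\<close>. For each index \<open>i\<close>, send a set to \<open>a\<close> or \<open>1\<close> according
  to whether it contains \<open>i\<close>, and \<open>\<infinity>\<close> to \<open>\<infinity>\<close>. This is not a homomorphism, but it preserves
  finite values of words; and the finite value of a word can be read off from its images in
  the coordinates, because there \<open>a\<close> means that \<open>i\<close> occurs exactly once and \<open>1\<close> that it does
  not occur.
\<close>

lemma sat_S7_imp_sat_Sc_gen:
  assumes sat: "sat S7 u q" and u: "ineq u q"
  shows "sat (Sc_gen n) u q"
proof (rule sat_Sc_genI)
  fix \<sigma> s
  assume \<sigma>: "range \<sigma> \<subseteq> carrier (Sc_gen n)" and vals: "\<And>w. w \<in> u \<Longrightarrow> word_val (Sc_gen n) \<sigma> w = Some s"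
  have ne: "q \<noteq> []" "\<And>w. w \<in> u \<Longrightarrow> w \<noteq> []" using u by (auto simp: ineq_def)
  obtain w0 where w0: "w0 \<in> u" using u by (auto simp: ineq_def)
  note s = card_word_val_Sc_gen[OF \<sigma> ne(2)[OF w0] vals[OF w0]]
  then have fin: "finite s" using finite_subset by blast
  have "length w0 > 0" using ne(2)[OF w0] by simp
  then have "card s > 0" using s by linarith
  then have n: "n > 0" using s by (cases n) auto
  define \<tau> where "\<tau> i x = (case \<sigma> x of None \<Rightarrow> S7_inf | Some t \<Rightarrow> if i \<in> t then S7_a else S7_one)" for i x
  define word where "word w = subst (\<lambda>x. subset_word n (\<sigma> x)) w" for w
  have fint: "finite t" if "\<sigma> x = Some t" for x t
  proof -
    have "Some t \<in> carrier (Sc_gen n)" using \<sigma> that by (metis rangeI subsetD)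
    then show ?thesis by (auto simp: Sc_gen_def intro: finite_subset)
  qed
  have count: "count (mset (word w)) i = length (filter (\<lambda>x. \<tau> i x = S7_a) w)"
    if "\<forall>x\<in>set w. \<sigma> x \<noteq> None" for w i
    using that
  proof (induction w)
    case (Cons x w)
    then obtain t where "\<sigma> x = Some t" by auto
    then show ?case using Cons fint[of x t] by (simp add: word_def subset_word_def \<tau>_def count_mset_set')
  qed (simp add: word_def)
  have not_None: "\<forall>x\<in>set w. \<sigma> x \<noteq> None" if "w \<noteq> []" "word_val (Sc_gen n) \<sigma> w = Some s'" for w s'
    using that
  proof (induction w arbitrary: s')
    case (Cons x w)
    then show ?case
      using word_val_Sc_gen_Cons[of w n \<sigma> x s'] by (cases "w = []") auto
  qed simp
  have inf_iff: "\<tau> i x = S7_inf \<longleftrightarrow> \<sigma> x = None" for i x by (simp add: \<tau>_def split: option.splits)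
  have q_val: "word_val S7 (\<tau> i) q = (if i \<in> s then S7_a else S7_one)" for i
  proof (rule sat_S7D[OF sat])
    fix w assume w: "w \<in> u"
    note nn = not_None[OF ne(2)[OF w] vals[OF w]]
    have "mset (word w) = mset_set s"
      using word_val_Sc_gen_iff[OF \<sigma> n ne(2)[OF w] fin] vals[OF w] by (simp add: word_def)
    then have cnt: "length (filter (\<lambda>x. \<tau> i x = S7_a) w) = (if i \<in> s then 1 else 0)"
      using count[OF nn, of i] fin by (simp add: count_mset_set')
    show "word_val S7 (\<tau> i) w = (if i \<in> s then S7_a else S7_one)"
    proof (cases "i \<in> s")
      case True
      then show ?thesis using cnt nn word_val_S7_a[OF ne(2)[OF w]] inf_iff by auto
    next
      case False
      then have "\<forall>x\<in>set w. \<tau> i x \<noteq> S7_a" using cnt by (simp add: filter_empty_conv)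
      then show ?thesis using False nn word_val_S7_one[OF ne(2)[OF w], of "\<tau> i"] inf_iff
        by (metis s7.exhaust)
    qed
  qed simp
  have nnq: "\<forall>x\<in>set q. \<sigma> x \<noteq> None"
  proof -
    obtain i where "i \<in> s" using \<open>card s > 0\<close> by fastforce
    then show ?thesis using q_val[of i] word_val_S7_a[OF ne(1), of "\<tau> i"] inf_iff by auto
  qed
  have "count (mset (word q)) i = count (mset_set s) i" for i
    using q_val[of i] word_val_S7_a[OF ne(1), of "\<tau> i"] word_val_S7_one[OF ne(1), of "\<tau> i"]
      count[OF nnq, of i] fin by (auto simp: count_mset_set' filter_empty_conv split: if_splits)
  then have "mset (word q) = mset_set s" by (simp add: multiset_eq_iff)
  then show "word_val (Sc_gen n) \<sigma> q = Some s"
    using word_val_Sc_gen_iff[OF \<sigma> n ne(1) fin] by (simp add: word_def)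
qed

lemma sat_S7_imp_sat_M2:
  assumes "sat S7 u q" "ineq u q"
  shows "sat M2 u q"
proof -
  have ne: "q \<noteq> []" "\<And>w. w \<in> u \<Longrightarrow> w \<noteq> []" using assms by (auto simp: ineq_def)
  let ?\<sigma> = "\<lambda>x. if x \<in> letters u then S7_one else S7_inf"
  have "word_val S7 ?\<sigma> w = S7_one" if "w \<in> u" for w
    using that word_val_S7_one[OF ne(2)[OF that], of ?\<sigma>] by (auto simp: letters_def)
  then have "word_val S7 ?\<sigma> q = S7_one" by (intro sat_S7D[OF assms(1)]) auto
  then have "set q \<subseteq> letters u" using word_val_S7_one[OF ne(1), of ?\<sigma>] by (auto split: if_splits)
  then show ?thesis using sat_M2[OF assms(2)] by simp
qed

lemma sat_Sc_gen_long:
  assumes "w \<in> u" "n < length w"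
  shows "sat (Sc_gen n) u q"
proof (rule sat_Sc_genI)
  fix \<sigma> s assume *: "range \<sigma> \<subseteq> carrier (Sc_gen n)" "\<And>w. w \<in> u \<Longrightarrow> word_val (Sc_gen n) \<sigma> w = Some s"
  have "w \<noteq> []" using assms(2) by auto
  then have "s \<subseteq> {..<n}" "length w \<le> card s"
    using card_word_val_Sc_gen[OF *(1)] *(2)[OF assms(1)] by blast+
  then have False using assms(2) card_mono[of "{..<n}" s] by simp
  then show "word_val (Sc_gen n) \<sigma> q = Some s" ..
qed

lemma sat_Sc_gen_0:
  assumes "ineq u q"
  shows "sat (Sc_gen 0) u q"
proof -
  obtain w where "w \<in> u" "w \<noteq> []" using assms by (auto simp: ineq_def)
  then show ?thesis by (intro sat_Sc_gen_long) auto
qed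

text \<open>
  In \<open>T\<^sub>2\<close> the top element \<open>1\<close> plays the role of \<open>\<infinity>\<close>, and \<open>0\<close> that of the single letter.
\<close>

lemma sat_T2_iff: "ineq u q \<Longrightarrow> sat T2 u q \<longleftrightarrow> sat (Sc_gen 1) u q"
proof (rule sat_iso[OF _ _ ai_semiring_T2])
  let ?h = "\<lambda>x :: nat. if x = 0 then Some {0 :: nat} else None"
  have c: "carrier (Sc_gen 1) = {None, Some {0}}"
    by (auto simp: Sc_gen_def subset_singleton_iff lessThan_Suc)
  show "?h \<in> hom T2 (Sc_gen 1)" unfolding hom_def c by (auto simp: T2_def Sc_gen_def)
  show "bij_betw ?h (carrier T2) (carrier (Sc_gen 1))"
    unfolding bij_betw_def c by (auto simp: T2_def inj_on_def)
qed

lemma sat_Sc_alg_iff: "ineq u q \<Longrightarrow> sat Sc_alg u q \<longleftrightarrow> sat (Sc_gen 2) u q"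
proof (rule sat_iso[OF _ _ ai_semiring_Sc])
  let ?h = "\<lambda>x. case x of Sc_a \<Rightarrow> Some {0 :: nat} | Sc_b \<Rightarrow> Some {1} | Sc_ab \<Rightarrow> Some {0, 1} | Sc_inf \<Rightarrow> None"
  have "Pow {..<2 :: nat} = {{}, {0}, {1}, {0, 1}}"
    by (auto simp: numeral_2_eq_2 lessThan_Suc Pow_insert)
  moreover have "{s. s \<noteq> {} \<and> s \<subseteq> {..<2 :: nat}} = Pow {..<2} - {{}}" by blast
  ultimately have "{s. s \<noteq> {} \<and> s \<subseteq> {..<2 :: nat}} = {{0}, {1}, {0, 1}}" by auto
  then have c: "carrier (Sc_gen 2) = {None, Some {0}, Some {1}, Some {0, 1}}"
    by (simp add: Sc_gen_def)
  show "?h \<in> hom Sc_alg (Sc_gen 2)" unfolding hom_def c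
    by (auto simp: Sc_alg_def Sc_gen_def doubleton_eq_iff split: sc.splits)
  have "carrier Sc_alg = {Sc_a, Sc_b, Sc_ab, Sc_inf}" using sc.exhaust by (auto simp: Sc_alg_def)
  then have "?h ` carrier Sc_alg = carrier (Sc_gen 2)"
    unfolding c by (simp add: insert_commute)
  moreover have "inj_on ?h (carrier Sc_alg)"
    by (rule inj_onI) (auto simp: doubleton_eq_iff split: sc.splits)
  ultimately show "bij_betw ?h (carrier Sc_alg) (carrier (Sc_gen 2))"
    unfolding bij_betw_def by blast
qed

text \<open>
  \<open>D\<^sub>2\<close> is the trivial semiring with a zero adjoined.
\<close>

lemma sat_D2:
  assumes "ineq u q"
  shows "sat D2 u q \<longleftrightarrow> within u q \<noteq> {}"
proof -
  let ?h = "\<lambda>x :: nat. if x = 0 then None else Some (None :: nat set option)"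
  have c: "carrier (adjoin_zero (Sc_gen 0)) = {None, Some None}"
    by (auto simp: Sc_gen_def carrier_adjoin_zero)
  have h: "?h \<in> hom D2 (adjoin_zero (Sc_gen 0))"
    unfolding hom_def c by (auto simp: D2_def Sc_gen_def adjoin_zero_def)
  have "bij_betw ?h (carrier D2) (carrier (adjoin_zero (Sc_gen 0)))"
    unfolding bij_betw_def c by (auto simp: D2_def inj_on_def)
  then have "sat D2 u q \<longleftrightarrow> sat (adjoin_zero (Sc_gen 0)) u q"
    using sat_iso[OF h _ ai_semiring_D2 assms] by blast
  then show ?thesis
    using sat_adjoin_zero[OF ai_semiring_Sc_gen assms] sat_Sc_gen_0 ineq_within[OF assms] by blast
qed

section \<open>Consequences of excluding a flat semiring\<close>

lemma finite_carrier_S7: "finite (carrier S7)"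
proof -
  have "UNIV = {S7_one, S7_a, S7_inf}" using s7.exhaust by auto
  then show ?thesis by (metis carrier_S7 finite.simps)
qed

lemma finite_carrier_adjoin_zero: "finite (carrier S) \<Longrightarrow> finite (carrier (adjoin_zero S))"
  by (simp add: carrier_adjoin_zero)

lemma exclude:
  fixes \<V> :: "'u alg set"
  assumes "infinite (UNIV :: 'u set)" "variety \<V>" "ai_semiring S" "\<not> copies S \<subseteq> \<V>"
  obtains u q where "ineq u (q :: 'u list)" "valid \<V> u q" "\<not> sat S u q"
proof -
  obtain C where C: "C \<in> copies S" "C \<notin> \<V>" using assms(4) by blast
  then have "ai_semiring C" using ai_semiring_copies[OF assms(3)] by blast
  then obtain u q where uq: "ineq u (q :: 'u list)" "valid \<V> u q" "\<not> sat C u q"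
    using birkhoff[OF assms(1,2)] C(2) by metis
  then show thesis using that[OF uq(1,2)] sat_copies[OF C(1) assms(3) uq(1)] by blast
qed

lemma valid_mem: "q \<in> u \<Longrightarrow> valid K u q"
  by (simp add: valid_def sat_mem)

lemma valid_mono: "valid K u q \<Longrightarrow> u \<subseteq> u' \<Longrightarrow> valid K u' q"
  unfolding valid_def using sat_mono by blast

lemma valid_cut:
  assumes "\<And>w. w \<in> u' \<Longrightarrow> valid K u w" "valid K u' q"
  shows "valid K u q"
  unfolding valid_def
proof
  fix A assume "A \<in> K"
  then show "sat A u q" using assms by (intro sat_cut[of u' A u q]) (auto simp: valid_def)
qed

lemma valid_cut1: "valid K u p \<Longrightarrow> valid K {p} q \<Longrightarrow> valid K u q"
  using valid_cut[of "{p}" K u q] by blast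

lemma doubled_subst:
  assumes "\<And>x. doubled (f x)"
  shows "doubled (subst f w)"
proof (induction w)
  case (Cons x w)
  have "2 \<le> count (mset (f x)) y + count (mset (subst f w)) y" if "y \<in> set (f x) \<or> y \<in> set (subst f w)" for y
    using that
  proof
    assume "y \<in> set (f x)"
    then have "2 \<le> count (mset (f x)) y" using assms unfolding doubled_def by blast
    then show ?thesis by linarith
  next
    assume "y \<in> set (subst f w)"
    then have "2 \<le> count (mset (subst f w)) y" using Cons unfolding doubled_def by blast
    then show ?thesis by linarith
  qed
  then show ?case by (simp add: doubled_def)
qed (simp add: doubled_def)

lemma doubled_append: "doubled w \<Longrightarrow> doubled w' \<Longrightarrow> doubled (w @ w')"
  using doubled_subst[of "\<lambda>x. if x then w else w'" "[True, False]"] by simp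

lemma doubled_pair: "doubled [x, x]"
  using doubled_append_self[of "[x]"] by simp

text \<open>
  Inside the locale validity in \<open>\<V>\<close> is a deduction relation: it is closed under cut,
  substitution and right multiplication, and its axioms are the inequalities of \<open>S\<^sub>7\<close>
  without foreign letters (\<open>valid_law\<close>).
\<close>

locale S7_zero_subvariety =
  fixes \<V> :: "'u alg set"
  assumes infinite_UNIV: "infinite (UNIV :: 'u set)"
    and variety: "variety \<V>"
    and subset: "\<V> \<subseteq> Var (copies (adjoin_zero S7))"
begin

lemma ai_semiring_member: "A \<in> \<V> \<Longrightarrow> ai_semiring A"
  using variety unfolding variety_def by blast

lemma valid_law:
  assumes "ineq u q" "letters u \<subseteq> set q" "sat S7 u q"
  shows "valid \<V> u q"
proof -
  note S = ai_semiring_adjoin_zero[OF ai_semiring_S7]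
  have "sat (adjoin_zero S7) u q"
    using sat_adjoin_zero[OF ai_semiring_S7 assms(1)] within_eq[OF assms(2)] assms(1,3)
    by (simp add: ineq_def)
  then have "valid (copies (adjoin_zero S7) :: 'u alg set) u q"
    using valid_copies[OF infinite_UNIV S _ assms(1)] finite_carrier_adjoin_zero[OF finite_carrier_S7]
    by blast
  then have "valid (Var (copies (adjoin_zero S7)) :: 'u alg set) u q"
    using valid_Var[OF ai_semiring_copies[OF S] assms(1)] by blast
  then show ?thesis using subset unfolding valid_def by blast
qed

lemma valid_perm: "mset w = mset w' \<Longrightarrow> w \<noteq> [] \<Longrightarrow> valid \<V> {w} w'"
  by (intro valid_law sat_S7_perm) (auto simp: ineq_def dest: mset_eq_setD)

lemma valid_doubled:
  assumes "ineq u q" "letters u = set q" "w \<in> u" "doubled w"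
  shows "valid \<V> u q"
  using assms sat_S7_doubled[of u q w] by (intro valid_law) auto

lemma valid_doubled1: "doubled w \<Longrightarrow> w \<noteq> [] \<Longrightarrow> set w = set q \<Longrightarrow> valid \<V> {w} q"
  by (rule valid_doubled[of _ _ w]) (auto simp: ineq_def)

lemma valid_subst:
  assumes "valid \<V> u q" "ineq u q" "\<And>x. f x \<noteq> []"
  shows "valid \<V> (subst f ` u) (subst f q)"
  unfolding valid_def using ai_semiring.sat_subst[OF ai_semiring_member _ assms(2,3)] assms(1)
  by (auto simp: valid_def)

lemma valid_append:
  assumes "valid \<V> {w} q" "w \<noteq> []" "q \<noteq> []"
  shows "valid \<V> {w @ r} (q @ r)"
  unfolding valid_def using ai_semiring.sat_append[OF ai_semiring_member _ assms(2,3)] assms(1)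
  by (auto simp: valid_def)

text \<open>
  Some valid inequality \<open>q \<le> u\<close> fails in \<open>Sc_gen n\<close>, where the words of \<open>u\<close> have the common
  value \<open>s\<close> and \<open>q\<close> does not. Replace each letter by the factors of its value and multiply
  by the indices missing in \<open>s\<close>. All words of \<open>u\<close> become \<open>x\<^sub>0\<dots>x\<^sub>n\<^sub>-\<^sub>1\<close> up to order, while
  \<open>q\<close> becomes a word \<open>q'\<close> in which some letter \<open>j\<close> does not occur exactly once. By symmetry
  \<open>x\<^sub>0\<dots>x\<^sub>n\<^sub>-\<^sub>1\<close> is also above the words obtained from \<open>q'\<close> by exchanging \<open>j\<close> with any \<open>i\<close>.
  If in \<open>S\<^sub>7\<close> all of these had the value \<open>a\<close>, then exactly one \<open>x\<^sub>i\<close> would be \<open>a\<close>, and the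
  exchange of \<open>i\<close> and \<open>j\<close> would give a contradiction. So their sum is never \<open>a\<close> and lies
  above the square.
\<close>

lemma valid_square_if_not_Sc_gen:
  assumes n: "n > 0" and excl: "\<not> copies (Sc_gen n) \<subseteq> \<V>"
  shows "valid \<V> {[0..<n]} ([0..<n] @ [0..<n])"
proof -
  obtain u q where uq: "ineq u (q :: 'u list)" "valid \<V> u q" "\<not> sat (Sc_gen n) u q"
    using exclude[OF infinite_UNIV variety ai_semiring_Sc_gen excl] .
  obtain \<sigma> s where \<sigma>: "range \<sigma> \<subseteq> carrier (Sc_gen n)"
    and vals: "\<And>w. w \<in> u \<Longrightarrow> word_val (Sc_gen n) \<sigma> w = Some s"
    and val_q: "word_val (Sc_gen n) \<sigma> q \<noteq> Some s"
    by (rule not_sat_Sc_genE[OF uq(3)]) blast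
  have ne: "q \<noteq> []" "\<And>w. w \<in> u \<Longrightarrow> w \<noteq> []" using uq(1) by (auto simp: ineq_def)
  obtain w0 where w0: "w0 \<in> u" using uq(1) by (auto simp: ineq_def)
  then have s: "s \<subseteq> {..<n}" "length w0 \<le> card s" and "length w0 > 0"
    using card_word_val_Sc_gen[OF \<sigma> ne(2) vals] ne(2) by auto
  then have fin: "finite s" and "s \<noteq> {}" by (auto intro: finite_subset)
  define f where "f = (\<lambda>x. subset_word n (\<sigma> x))"
  have f: "f x \<noteq> [] \<and> set (f x) \<subseteq> {..<n}" for x
  proof -
    have "\<sigma> x \<in> carrier (Sc_gen n)" using \<sigma> by blast
    then show ?thesis
      using n finite_subset[of _ "{..<n}"]
      by (cases "\<sigma> x") (auto simp: f_def subset_word_def Sc_gen_def)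
  qed
  define sl r where "sl = sorted_list_of_set s" and "r = sorted_list_of_set ({..<n} - s)"
  have sl: "sl \<noteq> []" "mset (sl @ r) = mset [0..<n]"
    using fin \<open>s \<noteq> {}\<close> s(1) mset_set_Union[of s "{..<n} - s"]
    by (auto simp: sl_def r_def Un_absorb1 mset_upt atLeast0LessThan simp flip: mset_set_Union)
  have "valid \<V> {sl} (subst f q)"
  proof (rule valid_cut)
    show "valid \<V> (subst f ` u) (subst f q)" using uq f by (intro valid_subst) auto
    fix v assume "v \<in> subst f ` u"
    then obtain w where w: "w \<in> u" "v = subst f w" by blast
    then have "mset v = mset sl"
      using word_val_Sc_gen_iff[OF \<sigma> n ne(2)[OF w(1)] fin] vals by (simp add: f_def sl_def)
    then show "valid \<V> {sl} v" using valid_perm[of sl v] sl by simp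
  qed
  define q' where "q' = subst f q @ r"
  have "valid \<V> {sl @ r} q'"
    unfolding q'_def using \<open>valid \<V> {sl} (subst f q)\<close> sl f ne
    by (intro valid_append) (auto simp: subst_eq_Nil)
  then have q': "valid \<V> {[0..<n]} q'"
    using valid_cut1[OF valid_perm[of "[0..<n]" "sl @ r"]] sl n by auto
  have set_q': "set q' \<subseteq> {..<n}" "q' \<noteq> []"
    using f ne by (auto simp: q'_def r_def subst_eq_Nil)
  have "mset q' \<noteq> mset [0..<n]"
  proof
    assume "mset q' = mset [0..<n]"
    then have "mset (subst f q) + mset r = mset sl + mset r" using sl(2) by (simp add: q'_def)
    then have "mset (subst f q) = mset_set s" by (simp add: sl_def)
    then show False using val_q word_val_Sc_gen_iff[OF \<sigma> n ne(1) fin] by (simp add: f_def)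
  qed
  then obtain j where j: "count (mset q') j \<noteq> count (mset [0..<n]) j"
    by (auto simp: multiset_eq_iff)
  have jn: "j < n" using j set_q' by (cases "j < n") (auto simp: not_in_iff[symmetric] count_eq_zero_iff)
  have cj: "count (mset q') j \<noteq> 1" using j jn by (simp add: mset_upt count_mset_set')
  define p where "p i = map (transpose i j) q'" for i
  have p: "valid \<V> {[0..<n]} (p i)" if i: "i < n" for i
  proof -
    have sub: "subst (\<lambda>x. [transpose i j x]) w = map (transpose i j) w" for w by (induction w) auto
    have "valid \<V> {map (transpose i j) [0..<n]} (p i)"
    proof -
      have "[0..<n] \<noteq> []" using n by simp
      then have "ineq {[0..<n]} q'" using set_q'(2) by (simp add: ineq_def eq_commute[of "[]"])
      then show ?thesis using valid_subst[OF q', of "\<lambda>x. [transpose i j x]"] by (simp add: sub p_def)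
    qed
    moreover have "mset [0..<n] = mset (map (transpose i j) [0..<n])"
    proof -
      have "transpose i j ` {0..<n} = {0..<n}" using i jn by (simp add: transpose_image_eq)
      then have "image_mset (transpose i j) (mset_set {0..<n}) = mset_set {0..<n}"
        using image_mset_mset_set[OF inj_on_subset[OF inj_transpose subset_UNIV], of i j "{0..<n}"]
        by simp
      then show ?thesis by simp
    qed
    moreover have "[0..<n] \<noteq> []" using n by simp
    ultimately show ?thesis using valid_cut1[OF valid_perm] by metis
  qed
  let ?U = "insert [0..<n] (p ` {..<n})"
  have "valid \<V> ?U ([0..<n] @ [0..<n])"
  proof (rule valid_law)
    show iU: "ineq ?U ([0..<n] @ [0..<n])" using n set_q' by (auto simp: ineq_def p_def eq_commute[of "[]" "[0..<n]"])
    show "letters ?U \<subseteq> set ([0..<n] @ [0..<n])"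
      using set_q' jn by (force simp: letters_def p_def transpose_def)
    show "sat S7 ?U ([0..<n] @ [0..<n])"
    proof (rule sat_S7_never_a[OF iU])
      fix \<tau> :: "nat \<Rightarrow> s7"
      show "\<exists>w\<in>?U. word_val S7 \<tau> w \<noteq> S7_a"
      proof (rule ccontr)
        assume "\<not> ?thesis"
        then have a: "word_val S7 \<tau> [0..<n] = S7_a" "\<And>i. i < n \<Longrightarrow> word_val S7 \<tau> (p i) = S7_a" by auto
        have "length (filter (\<lambda>x. \<tau> x = S7_a) [0..<n]) = 1" using a(1) n by (simp add: word_val_S7_a)
        then obtain i where "filter (\<lambda>x. \<tau> x = S7_a) [0..<n] = [i]" by (auto simp: length_Suc_conv)
        then have "set (filter (\<lambda>x. \<tau> x = S7_a) [0..<n]) = {i}" by simp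
        then have i: "i < n" "\<And>x. x < n \<Longrightarrow> \<tau> x = S7_a \<longleftrightarrow> x = i" by auto
        have "length (filter (\<lambda>x. \<tau> (transpose i j x) = S7_a) q') = 1"
          using a(2)[OF i(1)] set_q'(2) by (simp add: p_def word_val_map word_val_S7_a)
        moreover have "filter (\<lambda>x. \<tau> (transpose i j x) = S7_a) q' = filter ((=) j) q'"
        proof (rule filter_cong[OF refl])
          fix x assume "x \<in> set q'"
          then have "x < n" using set_q' by auto
          then have "transpose i j x < n" using i(1) jn by (auto simp: transpose_def)
          then show "\<tau> (transpose i j x) = S7_a \<longleftrightarrow> j = x" using i(2) by (auto simp: transpose_def)
        qed
        ultimately show False using cj by (simp add: count_mset count_list_eq_length_filter)
      qed
    qed (auto simp: letters_def)
  qed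
  then show ?thesis using p by (elim valid_cut[rotated]) (auto intro: valid_mem)
qed

text \<open>
  A valid inequality that fails in \<open>M\<^sub>2\<close> has a letter on the left that does not occur on the
  right. Replace this letter by \<open>y\<^sup>2\<close> and the others by \<open>x\<^sup>2\<close>.
\<close>

lemma valid_square_if_not_M2:
  assumes "\<not> copies M2 \<subseteq> \<V>"
  shows "valid \<V> {[0 :: nat, 0]} [0, 0, 1, 1]"
proof -
  obtain u q where uq: "ineq u (q :: 'u list)" "valid \<V> u q" "\<not> sat M2 u q"
    using exclude[OF infinite_UNIV variety ai_semiring_M2 assms] .
  then obtain y where y: "y \<in> set q" "y \<notin> letters u" using sat_M2 by blast
  define f where "f x = (if x = y then [1, 1] else [0 :: nat, 0])" for x
  have d: "doubled (subst f w)" for w by (rule doubled_subst) (simp add: f_def doubled_pair)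
  have ne: "q \<noteq> []" "\<And>w. w \<in> u \<Longrightarrow> w \<noteq> []" using uq(1) by (auto simp: ineq_def)
  have "valid \<V> {[0, 0]} (subst f q)"
  proof (rule valid_cut)
    show "valid \<V> (subst f ` u) (subst f q)" using uq by (intro valid_subst) (auto simp: f_def)
    fix v assume "v \<in> subst f ` u"
    then obtain w where w: "w \<in> u" "v = subst f w" by blast
    then have "y \<notin> set w" using y by (auto simp: letters_def)
    then have "set (f x) = {0}" if "x \<in> set w" for x using that by (auto simp: f_def)
    then have "set v = {0}" using w ne(2)[OF w(1)] by (cases w) auto
    then show "valid \<V> {[0, 0]} v" by (intro valid_doubled1) (auto simp: doubled_pair)
  qed
  then have "valid \<V> {[0, 0] @ [0, 0]} (subst f q @ [0, 0])"
    using ne by (intro valid_append) (auto simp: subst_eq_Nil f_def)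
  moreover have "valid \<V> {[0, 0]} ([0, 0 :: nat] @ [0, 0])"
    by (rule valid_doubled1) (auto simp: doubled_pair)
  moreover have "valid \<V> {subst f q @ [0, 0]} [0, 0, 1, 1]"
  proof (rule valid_doubled1)
    show "doubled (subst f q @ [0, 0])" using d doubled_pair by (rule doubled_append)
    show "set (subst f q @ [0, 0]) = set [0, 0, 1, 1]"
      using y(1) by (auto simp: f_def split: if_splits)
  qed simp
  ultimately show ?thesis by (meson valid_cut1)
qed

text \<open>
  A square is doubled, so it collapses all words that have the letters of \<open>u\<close>.
\<close>

lemma valid_if_square_letters:
  assumes "valid \<V> u (w @ w)" "w \<noteq> []" "set w \<subseteq> letters u" "ineq u q" "set q = letters u"
  shows "valid \<V> u q"
proof (rule valid_cut)
  show "valid \<V> (insert (w @ w) u) q"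
    using assms by (intro valid_doubled[of _ _ "w @ w"]) (auto simp: ineq_def doubled_append_self)
qed (use assms in \<open>auto intro: valid_mem\<close>)

text \<open>
  \<open>q \<le> w\<^sup>2q\<^sup>2 \<le> w\<^sup>2\<close>.
\<close>

lemma valid_if_square_within:
  assumes law: "valid \<V> {[0 :: nat, 0]} [0, 0, 1, 1]"
    and w: "valid \<V> u (w @ w)" "w \<noteq> []" "set w \<subseteq> set q"
  shows "valid \<V> u q"
proof -
  have "q \<noteq> []" using w by auto
  then have "valid \<V> {w @ w} (w @ w @ q @ q)"
    using valid_subst[OF law, of "\<lambda>x. if x = 0 then w else q"] w by (simp add: ineq_def)
  moreover have "valid \<V> {w @ w @ q @ q} q"
    using w doubled_append[OF doubled_append_self[of w] doubled_append_self[of q]]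
    by (intro valid_doubled1) auto
  ultimately show ?thesis using w(1) by (meson valid_cut1)
qed

text \<open>
  Write \<open>w\<close> as a product of \<open>n + 1\<close> words, the first \<open>n\<close> of them letters.
\<close>

lemma valid_square_long:
  assumes law: "valid \<V> {[0..<Suc n]} ([0..<Suc n] @ [0..<Suc n])" and w: "n < length w"
  shows "valid \<V> {w} (w @ w)"
proof -
  define f where "f i = (if i < n then [w ! i] else drop n w)" for i
  have "map f [0..<n] = map (\<lambda>i. [w ! i]) [0..<n]" by (simp add: f_def)
  then have "subst f [0..<n] = concat (map (\<lambda>i. [w ! i]) [0..<n])" by (simp only: subst_def)
  also have "\<dots> = map ((!) w) [0..<n]" by (induction n) auto
  also have "\<dots> = take n w" using w by (simp add: list_eq_iff_nth_eq)
  finally have eq: "subst f [0..<Suc n] = w" by (simp add: f_def)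
  have "f i \<noteq> []" for i using w by (simp add: f_def)
  then have "valid \<V> (subst f ` {[0..<Suc n]}) (subst f ([0..<Suc n] @ [0..<Suc n]))"
    by (intro valid_subst[OF law]) (auto simp: ineq_def)
  then show ?thesis using eq by (simp only: subst_append image_insert image_empty)
qed

end

section \<open>Words of bounded length in the semirings of subsets\<close>

definition finitely_valued :: "nat \<Rightarrow> 'v list set \<Rightarrow> bool" where
  "finitely_valued n u \<longleftrightarrow> (\<exists>\<sigma> s. range \<sigma> \<subseteq> carrier (Sc_gen n) \<and>
     (\<forall>w\<in>u. word_val (Sc_gen n) \<sigma> w = Some s))"

lemma sat_if_not_finitely_valued: "\<not> finitely_valued n u \<Longrightarrow> sat (Sc_gen n) u q"
  unfolding finitely_valued_def by (intro sat_Sc_genI) blast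

lemma finitely_valued_length:
  assumes "finitely_valued n u" "w \<in> u" "w \<noteq> []"
  shows "length w \<le> n"
proof -
  obtain \<sigma> s where \<sigma>: "range \<sigma> \<subseteq> carrier (Sc_gen n)" "\<forall>w\<in>u. word_val (Sc_gen n) \<sigma> w = Some s"
    using assms(1) unfolding finitely_valued_def by blast
  then have "s \<subseteq> {..<n}" "length w \<le> card s" using card_word_val_Sc_gen[OF \<sigma>(1) assms(3)] assms(2) by blast+
  then show ?thesis using card_mono[of "{..<n}" s] by simp
qed

text \<open>
  A letter of \<open>q\<close> that is foreign to \<open>u\<close> could be changed to \<open>\<infinity>\<close>.
\<close>

lemma finitely_valued_letters:
  assumes "finitely_valued n u" "sat (Sc_gen n) u q" "ineq u q"
  shows "set q \<subseteq> letters u"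
proof
  obtain \<sigma> s where \<sigma>: "range \<sigma> \<subseteq> carrier (Sc_gen n)" "\<forall>w\<in>u. word_val (Sc_gen n) \<sigma> w = Some s"
    using assms(1) unfolding finitely_valued_def by blast
  define \<tau> where "\<tau> x = (if x \<in> letters u then \<sigma> x else None)" for x
  have \<tau>: "range \<tau> \<subseteq> carrier (Sc_gen n)" using \<sigma>(1) by (auto simp: \<tau>_def Sc_gen_def image_subset_iff)
  have "word_val (Sc_gen n) \<tau> w = Some s" if w: "w \<in> u" for w
  proof -
    have "word_val (Sc_gen n) \<tau> w = word_val (Sc_gen n) \<sigma> w"
      using w by (intro word_val_cong) (auto simp: \<tau>_def letters_def)
    then show ?thesis using \<sigma>(2) w by simp
  qed
  then have q: "word_val (Sc_gen n) \<tau> q = Some s" by (rule sat_Sc_genD[OF assms(2) \<tau> assms(3)])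
  have not_None: "\<tau> x \<noteq> None" if "word_val (Sc_gen n) \<tau> v = Some t" "x \<in> set v" for v t x
    using that
  proof (induction v arbitrary: t)
    case (Cons y v)
    then show ?case using word_val_Sc_gen_Cons[of v n \<tau> y t] by (cases "v = []") auto
  qed simp
  fix x assume "x \<in> set q"
  then have "\<tau> x \<noteq> None" by (rule not_None[OF q])
  then show "x \<in> letters u" by (auto simp: \<tau>_def split: if_splits)
qed

lemma Sc_gen_1_constant:
  assumes "\<And>w. w \<in> u \<Longrightarrow> length w = 1"
  shows "range (\<lambda>x. Some {0}) \<subseteq> carrier (Sc_gen 1)"
    and "w \<in> u \<Longrightarrow> word_val (Sc_gen 1) (\<lambda>x. Some {0}) w = Some {0}"
  using assms[of w] by (auto simp: Sc_gen_def length_Suc_conv)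

text \<open>
  Words of length one and two are seen as vertices and edges of a graph; the vertices given
  as words are then required to lie on no edge.
\<close>

definition isolated_singletons :: "'v list set \<Rightarrow> bool" where
  "isolated_singletons u \<longleftrightarrow> (\<forall>w\<in>u. \<forall>x\<in>set w. [x] \<in> u \<longrightarrow> w = [x])"

text \<open>
  If all words of length at most two have the value \<open>a\<close> in \<open>S\<^sub>7\<close>, each edge has one end \<open>a\<close>
  and one end \<open>1\<close>. This is a bipartition, and together with the value \<open>ab\<close> at the isolated
  vertices it gives an assignment into \<open>S\<^sub>c(ab)\<close> for which all words have the value \<open>ab\<close>.
\<close>

definition colouring :: "'v list set \<Rightarrow> ('v \<Rightarrow> s7) \<Rightarrow> 'v \<Rightarrow> nat set option" where
  "colouring u \<tau> x = Some (if [x] \<in> u then {0, 1} else if \<tau> x = S7_a then {0} else {1})"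

lemma range_colouring: "range (colouring u \<tau>) \<subseteq> carrier (Sc_gen 2)"
  by (auto simp: colouring_def Sc_gen_def)

lemma length_le_2_cases:
  assumes "w \<noteq> []" "length w \<le> 2"
  obtains x where "w = [x]" | x y where "w = [x, y]"
  using assms by (cases w; cases "tl w") (auto simp: neq_Nil_conv)

lemma word_val_S7_pair_a:
  "word_val S7 \<tau> [x, y] = S7_a \<longleftrightarrow> \<tau> x = S7_a \<and> \<tau> y = S7_one \<or> \<tau> x = S7_one \<and> \<tau> y = S7_a"
  by (auto simp: S7_def)

lemma word_val_colouring:
  assumes "\<And>w. w \<in> u \<Longrightarrow> w \<noteq> [] \<and> length w \<le> 2" "isolated_singletons u"
    "\<And>w. w \<in> u \<Longrightarrow> word_val S7 \<tau> w = S7_a" "w \<in> u"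
  shows "word_val (Sc_gen 2) (colouring u \<tau>) w = Some {0, 1}"
proof -
  have "w \<noteq> []" "length w \<le> 2" using assms by auto
  then show ?thesis
  proof (cases rule: length_le_2_cases)
    case (1 x)
    then show ?thesis using assms(4) by (simp add: colouring_def)
  next
    case (2 x y)
    have "[x] \<notin> u" "[y] \<notin> u" using assms(2,4) 2 unfolding isolated_singletons_def by fastforce+
    moreover have "\<tau> x = S7_a \<and> \<tau> y = S7_one \<or> \<tau> x = S7_one \<and> \<tau> y = S7_a"
      using assms(3)[OF assms(4)] word_val_S7_pair_a 2 by metis
    ultimately show ?thesis using 2 by (auto simp: colouring_def Sc_gen_def)
  qed
qed

text \<open>
  A proper factor of a finite value is a proper subset of it.
\<close>

lemma finitely_valued_isolated:
  assumes "finitely_valued 2 u" "[] \<notin> u"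
  shows "isolated_singletons u"
  unfolding isolated_singletons_def
proof (intro ballI impI)
  obtain \<sigma> s where \<sigma>: "range \<sigma> \<subseteq> carrier (Sc_gen 2)" "\<forall>w\<in>u. word_val (Sc_gen 2) \<sigma> w = Some s"
    using assms(1) unfolding finitely_valued_def by blast
  have nonempty: "t \<noteq> {}" if "\<sigma> x = Some t" for x t
  proof -
    have "Some t \<in> carrier (Sc_gen 2)" using \<sigma>(1) that by (metis rangeI subsetD)
    then show ?thesis by (auto simp: Sc_gen_def)
  qed
  fix w x assume w: "w \<in> u" "x \<in> set w" "[x] \<in> u"
  then have "w \<noteq> []" "length w \<le> 2" using finitely_valued_length[OF assms(1)] assms(2) by auto
  then show "w = [x]"
  proof (cases rule: length_le_2_cases)
    case (1 y)
    then show ?thesis using w by simp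
  next
    case (2 y z)
    have "\<sigma> x = Some s" using \<sigma>(2) w(3) by force
    moreover obtain t r where "\<sigma> y = Some t" "\<sigma> z = Some r" "t \<inter> r = {}" "s = t \<union> r"
      using \<sigma>(2) w(1) 2 word_val_Sc_gen_Cons[of "[z]" 2 \<sigma> y s] by auto
    moreover then have "t \<noteq> {}" "r \<noteq> {}" using nonempty by blast+
    ultimately have False using w(2) 2 by auto blast+
    then show ?thesis ..
  qed
qed

text \<open>
  Only the bound \<open>a\<close> is of interest. For \<open>n = 1\<close> the word \<open>q\<close> is one of the letters in \<open>u\<close>.
  For \<open>n = 2\<close> the colouring turns the assignment into one with values in \<open>S\<^sub>c(ab)\<close>; there
  \<open>q\<close> has the value \<open>ab\<close>, so \<open>q\<close> is an isolated vertex or joins the two colours, and in both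
  cases it has the value \<open>a\<close> in \<open>S\<^sub>7\<close>.
\<close>

lemma sat_S7_if_finitely_valued:
  assumes n: "n \<le> 2" and u: "ineq u q" and sat: "sat (Sc_gen n) u q" and fin: "finitely_valued n u"
  shows "sat S7 u q"
proof (rule sat_S7I)
  have sub: "set q \<subseteq> letters u" using finitely_valued_letters[OF fin sat u] .
  have ne: "q \<noteq> []" "\<And>w. w \<in> u \<Longrightarrow> w \<noteq> []" using u by (auto simp: ineq_def)
  have len: "length w \<le> n" "w \<noteq> []" if "w \<in> u" for w
    using finitely_valued_length[OF fin that] ne that by auto
  show "word_val S7 \<tau> q = S7_one" if "\<And>w. w \<in> u \<Longrightarrow> word_val S7 \<tau> w = S7_one" for \<tau>
    using word_val_S7_one_letters[OF u sub that] .
  fix \<tau> assume a: "\<And>w. w \<in> u \<Longrightarrow> word_val S7 \<tau> w = S7_a"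
  obtain w0 where "w0 \<in> u" using u by (auto simp: ineq_def)
  then have "n \<noteq> 0" using len[of w0] by (cases w0) auto
  then consider "n = 1" | "n = 2" using n by linarith
  then show "word_val S7 \<tau> q = S7_a"
  proof cases
    case 1
    have len1: "length w = 1" if "w \<in> u" for w using len[OF that] 1 by (cases w) auto
    have "word_val (Sc_gen 1) (\<lambda>x. Some {0}) q = Some {0}"
      by (rule sat_Sc_genD[OF sat[unfolded 1] _ u]; rule Sc_gen_1_constant[OF len1])
    then have "length q \<le> card {0 :: nat}"
      using card_word_val_Sc_gen[OF Sc_gen_1_constant(1)[OF len1] ne(1)] by blast
    then obtain x where x: "q = [x]" using ne(1) by (cases q) auto
    then obtain w where "w \<in> u" "x \<in> set w" using sub by (auto simp: letters_def)
    then have "q \<in> u" using len1[of w] x by (auto simp: length_Suc_conv)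
    then show ?thesis using a by blast
  next
    case 2
    have iso: "isolated_singletons u" using finitely_valued_isolated fin ne(2) 2 by blast
    have "word_val (Sc_gen 2) (colouring u \<tau>) q = Some {0, 1}"
    proof (rule sat_Sc_genD[OF sat[unfolded 2] range_colouring u])
      show "word_val (Sc_gen 2) (colouring u \<tau>) w = Some {0, 1}" if "w \<in> u" for w
        by (rule word_val_colouring[OF _ iso a that]) (use len 2 in auto)
    qed
    note val = this
    have "length q \<le> card {0, 1 :: nat}" using card_word_val_Sc_gen[OF range_colouring ne(1) val] by blast
    then have "length q \<le> 2" by simp
    with ne(1) show ?thesis
    proof (cases rule: length_le_2_cases)
      case (1 x)
      then have "q \<in> u" using val by (auto simp: colouring_def split: if_splits)
      then show ?thesis using a by blast
    next
      case (2 x y)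
      obtain t r where tr: "colouring u \<tau> x = Some t" "colouring u \<tau> y = Some r" "t \<inter> r = {}"
        using val 2 word_val_Sc_gen_Cons[of "[y]" 2 "colouring u \<tau>" x "{0, 1}"] by auto
      have one: "\<tau> v = S7_one" if v: "v \<in> set q" "\<tau> v \<noteq> S7_a" for v
      proof -
        obtain w where w: "w \<in> u" "v \<in> set w" using sub v(1) by (auto simp: letters_def)
        then have "\<tau> v \<noteq> S7_inf" using a[OF w(1)] word_val_S7_a[of w \<tau>] ne(2) by auto
        then show ?thesis using v(2) by (cases "\<tau> v") auto
      qed
      have "(\<tau> x = S7_a) \<noteq> (\<tau> y = S7_a)"
        using tr by (auto simp: colouring_def split: if_splits)
      then show ?thesis using one[of x] one[of y] 2 word_val_S7_pair_a[of \<tau> x y] by auto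
    qed
  qed
qed

context S7_zero_subvariety
begin

text \<open>
  A word longer than \<open>n\<close> yields its own square. If there is none then \<open>n = 2\<close>, because words
  of length one can all be given the same finite value. Now either a vertex \<open>x\<close> lies on an
  edge \<open>xy\<close>, and \<open>x + xy\<close> is above \<open>xy\<^sup>2\<close>, a word of length three; or there is no
  bipartition, so \<open>u\<close> is never \<open>a\<close> in \<open>S\<^sub>7\<close> and lies above the square of the product of all
  its letters.
\<close>

lemma valid_square_if_not_finitely_valued:
  assumes n: "n \<le> 2" and law: "valid \<V> {[0..<Suc n]} ([0..<Suc n] @ [0..<Suc n])"
    and u: "ineq u q" and nfin: "\<not> finitely_valued n u"
  obtains w where "w \<noteq> []" "set w \<subseteq> letters u" "valid \<V> u (w @ w)"
proof (cases "\<exists>w\<in>u. n < length w")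
  case True
  then obtain w where w: "w \<in> u" "n < length w" by blast
  then have "valid \<V> u (w @ w)" using valid_square_long[OF law w(2)] valid_mono[of _ "{w}"] by blast
  moreover have "w \<noteq> []" "set w \<subseteq> letters u" using w by (auto simp: letters_def)
  ultimately show ?thesis using that by blast
next
  case False
  have ne: "\<And>w. w \<in> u \<Longrightarrow> w \<noteq> []" using u by (auto simp: ineq_def)
  have len: "length w \<le> n" "w \<noteq> []" if "w \<in> u" for w using False ne that by (auto simp: not_less)
  obtain w0 where w0: "w0 \<in> u" using u by (auto simp: ineq_def)
  then have "n \<noteq> 0" using len[of w0] by (cases w0) auto
  moreover have "n \<noteq> 1"
  proof
    assume 1: "n = 1"
    have len1: "length w = 1" if "w \<in> u" for w using len[OF that] 1 by (cases w) auto
    have "finitely_valued 1 u" unfolding finitely_valued_def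
      by (intro exI conjI ballI; rule Sc_gen_1_constant[OF len1])
    then show False using nfin 1 by blast
  qed
  ultimately have n2: "n = 2" using n by linarith
  show ?thesis
  proof (cases "isolated_singletons u")
    case True
    obtain p where p: "set p = letters u"
      using u finite_list[of "letters u"] by (auto simp: letters_def ineq_def)
    then have "p \<noteq> []" using w0 ne[OF w0] by (cases w0) (auto simp: letters_def)
    have "\<exists>w\<in>u. word_val S7 \<tau> w \<noteq> S7_a" for \<tau>
    proof (rule ccontr)
      assume "\<not> ?thesis"
      then have a: "word_val S7 \<tau> w = S7_a" if "w \<in> u" for w using that by blast
      have "word_val (Sc_gen 2) (colouring u \<tau>) w = Some {0, 1}" if "w \<in> u" for w
        by (rule word_val_colouring[OF _ True a that]) (use len n2 in auto)
      then have "finitely_valued 2 u" unfolding finitely_valued_def using range_colouring by metis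
      then show False using nfin n2 by blast
    qed
    then have "valid \<V> u (p @ p)"
      using u p \<open>p \<noteq> []\<close> by (intro valid_law sat_S7_never_a) (auto simp: ineq_def)
    then show ?thesis using that p \<open>p \<noteq> []\<close> by blast
  next
    case False
    then obtain w x where w: "w \<in> u" "x \<in> set w" "[x] \<in> u" "w \<noteq> [x]"
      unfolding isolated_singletons_def by blast
    have "w \<noteq> []" "length w \<le> 2" using len[OF w(1)] n2 by auto
    then obtain y where y: "w = [x, y] \<or> w = [y, x]"
      using w by (cases rule: length_le_2_cases) auto
    have "valid \<V> {[x], w} [x, y, y]"
    proof (rule valid_law)
      show i: "ineq {[x], w} [x, y, y]" using y by (auto simp: ineq_def)
      show "letters {[x], w} \<subseteq> set [x, y, y]" using y by auto
      show "sat S7 {[x], w} [x, y, y]"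
      proof (rule sat_S7I)
        fix \<tau> assume one: "\<And>v. v \<in> {[x], w} \<Longrightarrow> word_val S7 \<tau> v = S7_one"
        show "word_val S7 \<tau> [x, y, y] = S7_one" by (rule word_val_S7_one_letters[OF i _ one]) (use y in auto)
      next
        fix \<tau> assume "\<And>v. v \<in> {[x], w} \<Longrightarrow> word_val S7 \<tau> v = S7_a"
        then have "word_val S7 \<tau> [x] = S7_a" "word_val S7 \<tau> w = S7_a" by blast+
        then have "\<tau> x = S7_a" "\<tau> y = S7_one"
          using y word_val_S7_pair_a[of \<tau> x y] word_val_S7_pair_a[of \<tau> y x] by auto
        then show "word_val S7 \<tau> [x, y, y] = S7_a" by (simp add: S7_def)
      qed
    qed
    then have "valid \<V> u [x, y, y]" using valid_mono w by blast
    moreover have "valid \<V> {[x, y, y]} ([x, y, y] @ [x, y, y])"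
      using valid_square_long[OF law, of "[x, y, y]"] n2 by simp
    ultimately have "valid \<V> u ([x, y, y] @ [x, y, y])" by (rule valid_cut1)
    moreover have "set [x, y, y] \<subseteq> letters u" using y w(1) unfolding letters_def by force
    ultimately show ?thesis using that[of "[x, y, y]"] by blast
  qed
qed

end

section \<open>Preimages as intervals\<close>

text \<open>
  The six varieties of the proposition are \<open>base n m\<close> with \<open>n \<le> 2\<close>, where \<open>m\<close> tells whether
  \<open>M\<^sub>2\<close> is among the generators. As \<open>Sc_gen 0\<close> is trivial, \<open>base 0 True\<close> is \<open>V(M\<^sub>2)\<close>.
\<close>

definition base :: "nat \<Rightarrow> bool \<Rightarrow> 'u alg set" where
  "base n m = Var (copies (Sc_gen n) \<union> (if m then copies M2 else {}))"

definition base_zero :: "nat \<Rightarrow> bool \<Rightarrow> 'u alg set" where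
  "base_zero n m =
     Var (copies (adjoin_zero (Sc_gen n)) \<union> (if m then copies (adjoin_zero M2) else {}))"

lemma variety_eqI:
  fixes \<V> \<W> :: "'u alg set"
  assumes "infinite (UNIV :: 'u set)" "variety \<V>" "variety \<W>"
    and "\<And>u q :: 'u list. ineq u q \<Longrightarrow> valid \<W> u q \<longleftrightarrow> valid \<V> u q"
  shows "\<V> = \<W>"
  using assms by (intro equalityI variety_subsetI) auto

lemma valid_Var_copies:
  assumes "infinite (UNIV :: 'u set)" "ai_semiring S" "finite (carrier S)" "ineq u q"
  shows "valid (Var (copies S) :: 'u alg set) u q \<longleftrightarrow> sat S u q"
  using valid_Var[OF ai_semiring_copies[OF assms(2)] assms(4)] valid_copies[OF assms] by blast

lemma valid_Var_copies_Un:
  assumes "infinite (UNIV :: 'u set)" "ai_semiring S" "finite (carrier S)"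
    "ai_semiring T" "finite (carrier T)" "ineq u q"
  shows "valid (Var (copies S \<union> copies T) :: 'u alg set) u q \<longleftrightarrow> sat S u q \<and> sat T u q"
proof -
  have "(copies S \<union> copies T :: 'u alg set) \<subseteq> {A. ai_semiring A}"
    by (intro Un_least ai_semiring_copies assms)
  from valid_Var[OF this assms(6)] show ?thesis
    using valid_copies[OF assms(1-3,6)] valid_copies[OF assms(1,4-6)] by (simp add: valid_Un)
qed

lemma variety_Var_copies: "ai_semiring S \<Longrightarrow> variety (Var (copies S))"
  by (rule variety_Var[OF ai_semiring_copies])

lemma variety_Var_copies_Un:
  "ai_semiring S \<Longrightarrow> ai_semiring T \<Longrightarrow> variety (Var (copies S \<union> copies T))"
  by (intro variety_Var Un_least ai_semiring_copies)

lemma finite_carrier_M2: "finite (carrier M2)" by simp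

lemma finite_carrier_D2: "finite (carrier D2)" by (simp add: D2_def)

lemma finite_carrier_T2: "finite (carrier T2)" by (simp add: T2_def)

lemma finite_carrier_Sc_alg: "finite (carrier Sc_alg)"
proof -
  have "carrier Sc_alg = {Sc_a, Sc_b, Sc_ab, Sc_inf}" using sc.exhaust by (auto simp: Sc_alg_def)
  then show ?thesis by simp
qed

lemma variety_base: "variety (base n m)" and variety_base_zero: "variety (base_zero n m)"
  unfolding base_def base_zero_def
  by (intro variety_Var Un_least ai_semiring_copies ai_semiring_adjoin_zero ai_semiring_Sc_gen;
      simp add: ai_semiring_copies ai_semiring_adjoin_zero ai_semiring_M2)+

lemma valid_base:
  assumes "infinite (UNIV :: 'u set)" "ineq u q"
  shows "valid (base n m :: 'u alg set) u q \<longleftrightarrow> sat (Sc_gen n) u q \<and> (m \<longrightarrow> set q \<subseteq> letters u)"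
  using valid_Var_copies[OF assms(1) ai_semiring_Sc_gen[of n] finite_carrier_Sc_gen assms(2)]
    valid_Var_copies_Un[OF assms(1) ai_semiring_Sc_gen[of n] finite_carrier_Sc_gen
      ai_semiring_M2 finite_carrier_M2 assms(2)] sat_M2[OF assms(2)]
  by (simp add: base_def)

lemma valid_base_zero:
  assumes "infinite (UNIV :: 'u set)" "ineq u q"
  shows "valid (base_zero n m :: 'u alg set) u q \<longleftrightarrow> within u q \<noteq> {} \<and>
    sat (Sc_gen n) (within u q) q \<and> (m \<longrightarrow> set q \<subseteq> letters (within u q))"
  using valid_Var_copies[OF assms(1) ai_semiring_adjoin_zero[OF ai_semiring_Sc_gen[of n]]
      finite_carrier_adjoin_zero[OF finite_carrier_Sc_gen] assms(2)]
    valid_Var_copies_Un[OF assms(1) ai_semiring_adjoin_zero[OF ai_semiring_Sc_gen[of n]]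
      finite_carrier_adjoin_zero[OF finite_carrier_Sc_gen] ai_semiring_adjoin_zero[OF ai_semiring_M2]
      finite_carrier_adjoin_zero[OF finite_carrier_M2] assms(2)]
    sat_M2[OF ineq_within[OF assms(2)]]
    sat_adjoin_zero[OF ai_semiring_Sc_gen[of n] assms(2)] sat_adjoin_zero[OF ai_semiring_M2 assms(2)]
  by (auto simp: base_zero_def)

lemma valid_V_S7:
  assumes "infinite (UNIV :: 'u set)" "ineq u q"
  shows "valid (Var (copies S7) :: 'u alg set) u q \<longleftrightarrow> sat S7 u q"
  using valid_Var_copies[OF assms(1) ai_semiring_S7 finite_carrier_S7 assms(2)] .

lemma valid_V_S7_zero:
  assumes "infinite (UNIV :: 'u set)" "ineq u q"
  shows "valid (Var (copies (adjoin_zero S7)) :: 'u alg set) u q \<longleftrightarrow>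
    within u q \<noteq> {} \<and> sat S7 (within u q) q"
  using valid_Var_copies[OF assms(1) ai_semiring_adjoin_zero[OF ai_semiring_S7]
      finite_carrier_adjoin_zero[OF finite_carrier_S7] assms(2)]
    sat_adjoin_zero[OF ai_semiring_S7 assms(2)] by simp

lemma letters_within_subset: "letters (within u q) \<subseteq> letters u"
  by (auto simp: letters_def within_def)

lemma sat_S7_imp_base:
  assumes "sat S7 u q" "ineq u q"
  shows "sat (Sc_gen n) u q" "set q \<subseteq> letters u"
  using sat_S7_imp_sat_Sc_gen[OF assms] sat_S7_imp_sat_M2[OF assms] sat_M2[OF assms(2)] by auto

context
  assumes inf: "infinite (UNIV :: 'u set)"
begin

lemma base_subset_V_S7: "(base n m :: 'u alg set) \<subseteq> Var (copies S7)"
proof (rule variety_subsetI[OF inf variety_base variety_Var_copies[OF ai_semiring_S7]])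
  fix u and q :: "'u list"
  assume u: "ineq u q" and "valid (Var (copies S7) :: 'u alg set) u q"
  then have "sat S7 u q" by (simp add: valid_V_S7[OF inf])
  then show "valid (base n m :: 'u alg set) u q"
    using sat_S7_imp_base[OF _ u] by (simp add: valid_base[OF inf u])
qed

lemma base_zero_subset_V_S7_zero: "(base_zero n m :: 'u alg set) \<subseteq> Var (copies (adjoin_zero S7))"
proof (rule variety_subsetI[OF inf variety_base_zero
      variety_Var_copies[OF ai_semiring_adjoin_zero[OF ai_semiring_S7]]])
  fix u and q :: "'u list"
  assume u: "ineq u q" and "valid (Var (copies (adjoin_zero S7)) :: 'u alg set) u q"
  then have w: "within u q \<noteq> {}" "sat S7 (within u q) q" by (simp_all add: valid_V_S7_zero[OF inf])
  then show "valid (base_zero n m :: 'u alg set) u q"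
    using sat_S7_imp_base[OF w(2) ineq_within[OF u w(1)]] by (simp add: valid_base_zero[OF inf u])
qed

lemma base_subset_base_zero: "(base n m :: 'u alg set) \<subseteq> base_zero n m"
proof (rule variety_subsetI[OF inf variety_base variety_base_zero])
  fix u and q :: "'u list"
  assume u: "ineq u q" and v: "valid (base_zero n m :: 'u alg set) u q"
  have "within u q \<subseteq> u" by (auto simp: within_def)
  then show "valid (base n m :: 'u alg set) u q"
    using v letters_within_subset[of u q]
    by (auto simp: valid_base[OF inf u] valid_base_zero[OF inf u] intro: sat_mono)
qed

text \<open>
  If \<open>u\<close> is never finite in \<open>Sc_gen n\<close>, interpolate \<open>q \<le> p\<^sup>2 \<le> u\<close> with a word \<open>p\<close> that
  contains all letters of \<open>u\<close> and \<open>q\<close>: the right inequality has no foreign letters, so that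
  it survives the zero, and the left one holds in \<open>S\<^sub>7\<close>.
\<close>

lemma base_zero_Int_V_S7:
  assumes "n \<le> 2"
  shows "(base_zero n m :: 'u alg set) \<inter> Var (copies S7) \<subseteq> base n m" (is "?I \<subseteq> _")
proof (rule variety_subsetI[OF inf _ variety_base])
  have "variety (base_zero n m :: 'u alg set)" "variety (Var (copies S7) :: 'u alg set)"
    by (rule variety_base_zero, rule variety_Var_copies[OF ai_semiring_S7])
  then show "variety ?I"
    using variety_Inter[of "{base_zero n m, Var (copies S7)} :: 'u alg set set"] by simp
  fix u and q :: "'u list"
  assume u: "ineq u q" and "valid (base n m :: 'u alg set) u q"
  then have sat: "sat (Sc_gen n) u q" and m: "m \<longrightarrow> set q \<subseteq> letters u" by (simp_all add: valid_base[OF inf u])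
  have mono: "valid ?I u' q'" if "valid (base_zero n m :: 'u alg set) u' q' \<or> valid (Var (copies S7) :: 'u alg set) u' q'"
    for u' and q' :: "'u list" using that unfolding valid_def by blast
  show "valid ?I u q"
  proof (cases "finitely_valued n u")
    case True
    then show ?thesis
      using sat_S7_if_finitely_valued[OF assms u sat] valid_V_S7[OF inf u] mono by blast
  next
    case False
    have "finite (letters u \<union> set q)" using u by (auto simp: letters_def ineq_def)
    from finite_list[OF this] obtain p where p: "set p = letters u \<union> set q" ..
    have "p \<noteq> []" using p u by (auto simp: ineq_def)
    then have ip: "ineq u (p @ p)" "ineq {p @ p} q" using u by (auto simp: ineq_def)
    have w: "within u (p @ p) = u" using p by (intro within_eq) auto
    then have "valid (base_zero n m :: 'u alg set) u (p @ p)"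
      using sat_if_not_finitely_valued[OF False] p m u
      by (auto simp: valid_base_zero[OF inf ip(1)] ineq_def)
    moreover have "sat S7 {p @ p} q"
      using p by (intro sat_S7_doubled[OF ip(2)]) (auto simp: doubled_append_self)
    ultimately show ?thesis using mono valid_V_S7[OF inf ip(2)] valid_cut1 by metis
  qed
qed

text \<open>
  Words with more than \<open>n\<close> letters are never finite in \<open>Sc_gen n\<close>; this separates it from
  \<open>Sc_gen (n + 1)\<close>, where \<open>x\<^sub>0\<dots>x\<^sub>n\<close> has a finite value, but its square does not.
\<close>

lemma Sc_gen_Suc_not_in_base:
  "\<not> copies (Sc_gen (Suc n)) \<subseteq> (base n m :: 'u alg set)"
proof
  let ?w = "[0..<Suc n]"
  have i: "ineq {?w} (?w @ ?w)" by (simp add: ineq_def eq_commute[of "[]"] del: upt_Suc)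
  assume "copies (Sc_gen (Suc n)) \<subseteq> (base n m :: 'u alg set)"
  moreover have "valid (base n m :: 'u alg set) {?w} (?w @ ?w)"
    unfolding valid_base[OF inf i] by (auto intro: sat_Sc_gen_long)
  ultimately have "valid (copies (Sc_gen (Suc n)) :: 'u alg set) {?w} (?w @ ?w)"
    unfolding valid_def by blast
  then have sat: "sat (Sc_gen (Suc n)) {?w} (?w @ ?w)"
    using valid_copies[OF inf ai_semiring_Sc_gen finite_carrier_Sc_gen i] by blast
  define \<sigma> where "\<sigma> i = (if i < Suc n then Some {i} else None)" for i :: nat
  have \<sigma>: "range \<sigma> \<subseteq> carrier (Sc_gen (Suc n))" by (auto simp: \<sigma>_def Sc_gen_def)
  have "subst (\<lambda>x. subset_word (Suc n) (\<sigma> x)) w = w" if "set w \<subseteq> {..<Suc n}" for w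
    using that by (induction w) (auto simp: subset_word_def \<sigma>_def)
  then have "mset (subst (\<lambda>x. subset_word (Suc n) (\<sigma> x)) ?w) = mset_set {..<Suc n}"
    by (metis atLeastLessThan_upt lessThan_atLeast0 mset_upt order_refl)
  then have "word_val (Sc_gen (Suc n)) \<sigma> ?w = Some {..<Suc n}"
    using word_val_Sc_gen_iff[OF \<sigma>, of ?w "{..<Suc n}"] by simp
  then have "word_val (Sc_gen (Suc n)) \<sigma> (?w @ ?w) = Some {..<Suc n}"
    by (intro sat_Sc_genD[OF sat \<sigma> i]) auto
  then have "length (?w @ ?w) \<le> card {..<Suc n}"
    using card_word_val_Sc_gen[OF \<sigma>, of "?w @ ?w"] by (simp del: upt_Suc)
  then show False by simp
qed

text \<open>
  The inequality \<open>y \<le> x\<^sup>n\<^sup>+\<^sup>1\<close> separates, since \<open>x\<^sup>n\<^sup>+\<^sup>1\<close> is never finite in \<open>Sc_gen n\<close>.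
\<close>

lemma M2_not_in_base: "\<not> copies M2 \<subseteq> (base n False :: 'u alg set)"
proof
  let ?w = "replicate (Suc n) (0 :: nat)"
  have i: "ineq {?w} [1]" by (auto simp: ineq_def)
  assume "copies M2 \<subseteq> (base n False :: 'u alg set)"
  moreover have "valid (base n False :: 'u alg set) {?w} [1]"
    unfolding valid_base[OF inf i] by (auto intro: sat_Sc_gen_long)
  ultimately have "valid (copies M2 :: 'u alg set) {?w} [1]" unfolding valid_def by blast
  then have "sat M2 {?w} [1]" using valid_copies[OF inf ai_semiring_M2 finite_carrier_M2 i] by blast
  then show False using sat_M2[OF i] by auto
qed

text \<open>
  After deletion of the words with letters foreign to \<open>q\<close>, either the inequality comes from
  \<open>S\<^sub>7\<close>, or some square \<open>v\<^sup>2\<close> is below the remaining words. In the second case the letters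
  of \<open>q\<close> are those of the remaining words if \<open>M\<^sub>2\<close> is a generator; if not, \<open>M\<^sub>2\<close> is excluded
  from \<open>\<V>\<close> and \<open>v\<^sup>2\<close> lies above every word that contains the letters of \<open>v\<close>.
\<close>

lemma subset_base_zero:
  fixes \<V> :: "'u alg set"
  assumes n: "n \<le> 2" and V: "variety \<V>" "\<V> \<subseteq> Var (copies (adjoin_zero S7))"
    and int: "\<V> \<inter> Var (copies S7) = base n m"
  shows "\<V> \<subseteq> base_zero n m"
proof (rule variety_subsetI[OF inf V(1) variety_base_zero])
  interpret S7_zero_subvariety \<V> using inf V by unfold_locales
  have Sc: "\<not> copies (Sc_gen (Suc n)) \<subseteq> \<V>"
  proof -
    have "copies (Sc_gen (Suc n)) \<subseteq> (base (Suc n) False :: 'u alg set)"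
      by (auto simp: base_def Var_def)
    then have "copies (Sc_gen (Suc n)) \<subseteq> (Var (copies S7) :: 'u alg set)"
      using base_subset_V_S7 by blast
    then show ?thesis using Sc_gen_Suc_not_in_base[of n m] int by blast
  qed
  note law = valid_square_if_not_Sc_gen[OF zero_less_Suc Sc]
  fix u and q :: "'u list"
  assume u: "ineq u q" and "valid (base_zero n m :: 'u alg set) u q"
  then have w: "within u q \<noteq> {}" "sat (Sc_gen n) (within u q) q" "m \<longrightarrow> set q \<subseteq> letters (within u q)"
    by (simp_all add: valid_base_zero[OF inf u])
  note i = ineq_within[OF u w(1)]
  have "valid \<V> (within u q) q"
  proof (cases "finitely_valued n (within u q)")
    case True
    then show ?thesis
      using sat_S7_if_finitely_valued[OF n i w(2)] valid_law[OF i letters_within] by blast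
  next
    case False
    obtain v where v: "v \<noteq> []" "set v \<subseteq> letters (within u q)" "valid \<V> (within u q) (v @ v)"
      by (rule valid_square_if_not_finitely_valued[OF n law i False])
    show ?thesis
    proof (cases m)
      case True
      then have "set q = letters (within u q)" using w(3) letters_within[of u q] by blast
      then show ?thesis using valid_if_square_letters[OF v(3,1,2) i] by blast
    next
      case False
      have "copies M2 \<subseteq> (base 0 True :: 'u alg set)" by (auto simp: base_def Var_def)
      then have "copies M2 \<subseteq> (Var (copies S7) :: 'u alg set)" using base_subset_V_S7 by blast
      then have "\<not> copies M2 \<subseteq> \<V>" using M2_not_in_base[of n] int False by auto
      note sq = valid_square_if_not_M2[OF this]
      have "set v \<subseteq> set q" using v(2) letters_within[of u q] by blast
      then show ?thesis by (rule valid_if_square_within[OF sq v(3,1)])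
    qed
  qed
  moreover have "within u q \<subseteq> u" by (auto simp: within_def)
  ultimately show "valid \<V> u q" by (rule valid_mono)
qed

theorem preimage_eq_interval:
  assumes "n \<le> 2"
  shows "{\<V> \<in> subvarieties (Var (copies (adjoin_zero S7))). \<V> \<inter> Var (copies S7) = (base n m :: 'u alg set)}
    = interval (base n m) (base_zero n m)"
proof (intro equalityI subsetI)
  fix \<V> :: "'u alg set"
  assume "\<V> \<in> {\<V> \<in> subvarieties (Var (copies (adjoin_zero S7))). \<V> \<inter> Var (copies S7) = base n m}"
  then have "variety \<V>" "\<V> \<subseteq> Var (copies (adjoin_zero S7))" "\<V> \<inter> Var (copies S7) = base n m"
    by (auto simp: subvarieties_def)
  then show "\<V> \<in> interval (base n m) (base_zero n m)"
    using subset_base_zero[OF assms] unfolding interval_def by blast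
next
  fix \<V> :: "'u alg set"
  assume "\<V> \<in> interval (base n m) (base_zero n m)"
  then have V: "variety \<V>" "base n m \<subseteq> \<V>" "\<V> \<subseteq> base_zero n m" by (auto simp: interval_def)
  then have "\<V> \<inter> Var (copies S7) = base n m"
    using base_zero_Int_V_S7[OF assms, of m] base_subset_V_S7[of n m] by blast
  then show "\<V> \<in> {\<V> \<in> subvarieties (Var (copies (adjoin_zero S7))). \<V> \<inter> Var (copies S7) = base n m}"
    using V base_zero_subset_V_S7_zero[of n m] by (auto simp: subvarieties_def)
qed

section \<open>Identifying the generated varieties\<close>

lemma trivial_variety_eq_base: "(trivial_variety :: 'u alg set) = base 0 False"
proof (intro equalityI subsetI)
  fix A :: "'u alg" assume "A \<in> trivial_variety"
  then obtain x where A: "ai_semiring A" "carrier A = {x}" by (auto simp: trivial_variety_def)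
  interpret ai_semiring A by fact
  show "A \<in> base 0 False"
  proof (rule birkhoff[OF inf variety_base A(1)])
    fix u and q :: "'u list" assume "ineq u q"
    then have "q \<noteq> []" by (simp add: ineq_def)
    then have "le A (word_val A \<sigma> q) z" if "range \<sigma> \<subseteq> carrier A" "z \<in> carrier A" for \<sigma> z
      using word_val_closed[OF that(1)] that(2) A(2) le_refl by auto
    then show "sat A u q" by (intro satI)
  qed
next
  fix A :: "'u alg" assume A: "A \<in> base 0 False"
  then interpret ai_semiring A using variety_base unfolding variety_def by blast
  have i: "ineq {[1 :: nat]} [0]" by (simp add: ineq_def)
  have "valid (base 0 False :: 'u alg set) {[1 :: nat]} [0]"
    using sat_Sc_gen_0[OF i] unfolding valid_base[OF inf i] by blast
  then have sat: "sat A {[1 :: nat]} [0]" using A by (simp add: valid_def)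
  have le: "le A x y" if "x \<in> carrier A" "y \<in> carrier A" for x y
    using satD[OF sat, of "\<lambda>i. if i = 0 then x else y" y] that by (auto intro: le_refl)
  obtain x where x: "x \<in> carrier A" using nonempty by blast
  then have "carrier A = {x}" using le_antisym[OF _ x] le x by blast
  then show "A \<in> trivial_variety" using ai_semiring_axioms by (auto simp: trivial_variety_def)
qed

lemma V_D2_eq_base_zero: "(Var (copies D2) :: 'u alg set) = base_zero 0 False"
proof (rule variety_eqI[OF inf variety_Var_copies[OF ai_semiring_D2] variety_base_zero])
  fix u and q :: "'u list" assume u: "ineq u q"
  show "valid (base_zero 0 False :: 'u alg set) u q \<longleftrightarrow> valid (Var (copies D2) :: 'u alg set) u q"
    using sat_Sc_gen_0[OF ineq_within[OF u]]
    unfolding valid_base_zero[OF inf u] valid_Var_copies[OF inf ai_semiring_D2 finite_carrier_D2 u]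
      sat_D2[OF u] by blast
qed

lemma V_M2_eq_base: "(Var (copies M2) :: 'u alg set) = base 0 True"
  using valid_Var_copies[OF inf ai_semiring_M2 finite_carrier_M2] sat_M2 sat_Sc_gen_0
  by (intro variety_eqI[OF inf variety_Var_copies[OF ai_semiring_M2] variety_base])
    (auto simp: valid_base[OF inf])

lemma V_M2_zero_eq_base_zero: "(Var (copies (adjoin_zero M2)) :: 'u alg set) = base_zero 0 True"
proof (rule variety_eqI[OF inf variety_Var_copies variety_base_zero])
  note M = ai_semiring_adjoin_zero[OF ai_semiring_M2] finite_carrier_adjoin_zero[OF finite_carrier_M2]
  show "ai_semiring (adjoin_zero M2)" by (rule M)
  fix u and q :: "'u list" assume u: "ineq u q"
  show "valid (base_zero 0 True :: 'u alg set) u q \<longleftrightarrow> valid (Var (copies (adjoin_zero M2)) :: 'u alg set) u q"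
    using sat_Sc_gen_0[OF ineq_within[OF u]] sat_M2[OF ineq_within[OF u]]
    unfolding valid_base_zero[OF inf u] valid_Var_copies[OF inf M u]
      sat_adjoin_zero[OF ai_semiring_M2 u] by blast
qed

text \<open>
  Adjoining a zero to \<open>S\<close>, and joining \<open>M\<^sub>2\<close>, changes the valid inequalities in a way that
  depends only on those of \<open>S\<close>.
\<close>

lemma V_eq_base:
  assumes S: "ai_semiring S" "finite (carrier S)"
    and sat_eq: "\<forall>(u :: 'u list set) q. ineq u q \<longrightarrow> (sat S u q \<longleftrightarrow> sat (Sc_gen n) u q)"
  shows "(Var (copies S) :: 'u alg set) = base n False"
    and "(Var (copies (adjoin_zero S)) :: 'u alg set) = base_zero n False"
    and "(Var (copies M2 \<union> copies S) :: 'u alg set) = base n True"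
    and "(Var (copies (adjoin_zero M2) \<union> copies (adjoin_zero S)) :: 'u alg set) = base_zero n True"
proof -
  have eq: "sat S u q \<longleftrightarrow> sat (Sc_gen n) u q" if "ineq u q" for u and q :: "'u list"
    using sat_eq that by blast
  note M = ai_semiring_M2 finite_carrier_M2
  note S0 = ai_semiring_adjoin_zero[OF S(1)] finite_carrier_adjoin_zero[OF S(2)]
  note M0 = ai_semiring_adjoin_zero[OF M(1)] finite_carrier_adjoin_zero[OF M(2)]
  show "(Var (copies S) :: 'u alg set) = base n False"
    by (rule variety_eqI[OF inf variety_Var_copies[OF S(1)] variety_base])
      (simp add: valid_base[OF inf] valid_Var_copies[OF inf S] eq)
  show "(Var (copies M2 \<union> copies S) :: 'u alg set) = base n True"
    by (rule variety_eqI[OF inf variety_Var_copies_Un[OF M(1) S(1)] variety_base])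
      (auto simp: valid_base[OF inf] valid_Var_copies_Un[OF inf M S] eq sat_M2)
  show "(Var (copies (adjoin_zero S)) :: 'u alg set) = base_zero n False"
  proof (rule variety_eqI[OF inf variety_Var_copies[OF S0(1)] variety_base_zero])
    fix u and q :: "'u list" assume u: "ineq u q"
    show "valid (base_zero n False :: 'u alg set) u q \<longleftrightarrow> valid (Var (copies (adjoin_zero S)) :: 'u alg set) u q"
      using eq[OF ineq_within[OF u]]
      unfolding valid_base_zero[OF inf u] valid_Var_copies[OF inf S0 u] sat_adjoin_zero[OF S(1) u] by blast
  qed
  show "(Var (copies (adjoin_zero M2) \<union> copies (adjoin_zero S)) :: 'u alg set) = base_zero n True"
  proof (rule variety_eqI[OF inf variety_Var_copies_Un[OF M0(1) S0(1)] variety_base_zero])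
    fix u and q :: "'u list" assume u: "ineq u q"
    show "valid (base_zero n True :: 'u alg set) u q \<longleftrightarrow>
      valid (Var (copies (adjoin_zero M2) \<union> copies (adjoin_zero S)) :: 'u alg set) u q"
      using eq[OF ineq_within[OF u]] sat_M2[OF ineq_within[OF u]]
      unfolding valid_base_zero[OF inf u] valid_Var_copies_Un[OF inf M0 S0 u]
        sat_adjoin_zero[OF S(1) u] sat_adjoin_zero[OF M(1) u] by blast
  qed
qed

section \<open>The two finite intervals\<close>

lemma valid_base_zero_0:
  assumes "ineq u q"
  shows "valid (base_zero 0 m :: 'u alg set) u q \<longleftrightarrow>
    within u q \<noteq> {} \<and> (m \<longrightarrow> set q \<subseteq> letters (within u q))"
  using sat_Sc_gen_0[OF ineq_within[OF assms]] by (auto simp: valid_base_zero[OF inf assms])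

lemma S7_zero_subvariety_base_zero:
  "variety \<V> \<Longrightarrow> (\<V> :: 'u alg set) \<subseteq> base_zero n m \<Longrightarrow> S7_zero_subvariety \<V>"
  using inf base_zero_subset_V_S7_zero[of n m] by unfold_locales auto

lemma valid_same_letters:
  assumes "(\<V> :: 'u alg set) \<subseteq> base_zero 0 True" "w \<noteq> []" "set w = set q"
  shows "valid \<V> {w} q"
proof -
  have i: "ineq {w} q" and w: "within {w} q = {w}" using assms by (auto simp: ineq_def within_def)
  have "valid (base_zero 0 True :: 'u alg set) {w} q"
    using assms(3) by (simp add: valid_base_zero_0[OF i] w)
  then show ?thesis using assms(1) unfolding valid_def by blast
qed

text \<open>
  A valid inequality \<open>q \<le> u\<close> that fails in \<open>D\<^sub>2\<close> has a letter foreign to \<open>q\<close> in each word of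
  \<open>u\<close>. Replace the letters of \<open>q\<close> by \<open>x\<close> and the foreign ones by \<open>xy\<close>.
\<close>

lemma valid_drop_letter:
  fixes \<V> :: "'u alg set"
  assumes V: "variety \<V>" "\<V> \<subseteq> base_zero 0 True" and D2: "\<not> base_zero 0 False \<subseteq> \<V>"
  shows "valid \<V> {[0 :: nat, 1]} [0]"
proof -
  interpret S7_zero_subvariety \<V> using S7_zero_subvariety_base_zero[OF V] .
  note same = valid_same_letters[OF V(2)]
  obtain u and q :: "'u list" where u: "ineq u q" "valid \<V> u q"
    and "\<not> valid (base_zero 0 False :: 'u alg set) u q"
    using D2 variety_subsetI[OF inf variety_base_zero V(1)] by blast
  then have empty: "within u q = {}" by (simp add: valid_base_zero_0)
  define f where "f x = (if x \<in> set q then [0] else [0 :: nat, 1])" for x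
  have "q \<noteq> []" using u by (simp add: ineq_def)
  then have set_q: "set (subst f q) = {0}" "subst f q \<noteq> []" by (auto simp: f_def subst_eq_Nil)
  have "valid \<V> {[0, 1]} (subst f q)"
  proof (rule valid_cut)
    show "valid \<V> (subst f ` u) (subst f q)" using u by (intro valid_subst) (auto simp: f_def)
    fix v assume "v \<in> subst f ` u"
    then obtain w where w: "w \<in> u" "v = subst f w" by blast
    then obtain x where "x \<in> set w" "x \<notin> set q" using empty by (auto simp: within_def)
    then have "set v = {0, 1}" using w by (auto simp: f_def split: if_splits)
    then show "valid \<V> {[0, 1]} v" by (intro same) auto
  qed
  moreover have "valid \<V> {subst f q} [0]" using set_q by (intro same) auto
  ultimately show ?thesis by (rule valid_cut1)
qed

lemma base_zero_False_subset_True: "(base_zero 0 False :: 'u alg set) \<subseteq> base_zero 0 True"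
  by (rule variety_subsetI[OF inf variety_base_zero variety_base_zero]) (simp add: valid_base_zero_0)

text \<open>
  Without \<open>D\<^sub>2\<close>, \<open>q \<le> qw \<le> w\<close> for all words \<open>q\<close> and \<open>w\<close>, so all words are equal.
\<close>

lemma interval_trivial:
  "interval (base 0 False) (base_zero 0 False) = {base 0 False, base_zero 0 False :: 'u alg set}"
proof (intro equalityI subsetI)
  fix \<V> :: "'u alg set"
  assume "\<V> \<in> interval (base 0 False) (base_zero 0 False)"
  then have V: "variety \<V>" "base 0 False \<subseteq> \<V>" "\<V> \<subseteq> base_zero 0 False" by (auto simp: interval_def)
  interpret S7_zero_subvariety \<V> using S7_zero_subvariety_base_zero[OF V(1,3)] .
  show "\<V> \<in> {base 0 False, base_zero 0 False}"
  proof (cases "base_zero 0 False \<subseteq> \<V>")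
    case False
    then have drop: "valid \<V> {[0 :: nat, 1]} [0]"
      using valid_drop_letter[OF V(1)] V(3) base_zero_False_subset_True by blast
    have "\<V> \<subseteq> base 0 False"
    proof (rule variety_subsetI[OF inf V(1) variety_base])
      fix u and q :: "'u list" assume u: "ineq u q"
      then obtain w where w: "w \<in> u" "w \<noteq> []" and q: "q \<noteq> []" by (auto simp: ineq_def)
      have i: "ineq {w} (q @ w)" using w q by (auto simp: ineq_def)
      have "within {w} (q @ w) = {w}" by (auto simp: within_def)
      then have "valid \<V> {w} (q @ w)" using V(3) valid_base_zero_0[OF i, of False] unfolding valid_def by blast
      moreover have "valid \<V> {q @ w} q"
        using valid_subst[OF drop, of "\<lambda>i. if i = 0 then q else w"] w q by (simp add: ineq_def)
      ultimately have "valid \<V> {w} q" by (rule valid_cut1)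
      then show "valid \<V> u q" using w by (auto intro: valid_mono)
    qed
    then show ?thesis using V by blast
  qed (use V in blast)
next
  fix \<V> :: "'u alg set" assume "\<V> \<in> {base 0 False, base_zero 0 False}"
  then show "\<V> \<in> interval (base 0 False) (base_zero 0 False)"
    using variety_base[of 0 False] variety_base_zero[of 0 False] base_subset_base_zero[of 0 False]
    unfolding interval_def by blast
qed

lemma V_M2_D2:
  fixes \<M> :: "'u alg set"
  defines "\<M> \<equiv> Var (copies M2 \<union> copies D2)"
  shows "variety \<M>" and "ineq u q \<Longrightarrow> valid \<M> u q \<longleftrightarrow> set q \<subseteq> letters u \<and> within u q \<noteq> {}"
  unfolding \<M>_def
  using variety_Var_copies_Un[OF ai_semiring_M2 ai_semiring_D2]
    valid_Var_copies_Un[OF inf ai_semiring_M2 finite_carrier_M2 ai_semiring_D2 finite_carrier_D2, of u q]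
  by (auto simp: sat_M2 sat_D2)

text \<open>
  Take a valid inequality \<open>q \<le> u\<close> that fails in \<open>M\<^sub>2\<^sup>0\<close>. As it holds in \<open>D\<^sub>2\<close>, some words of
  \<open>u\<close> have no letter foreign to \<open>q\<close>, but these words miss a letter of \<open>q\<close>. Replace their
  letters by \<open>x\<close>, the other letters of \<open>q\<close> by \<open>y\<close>, and the letters foreign to \<open>q\<close> by \<open>xyz\<close>.
  Then \<open>q\<close> becomes \<open>xy\<close>, and \<open>u\<close> becomes a sum of words \<open>x\<close> and \<open>xyz\<close>.
\<close>

lemma valid_absorb_letter:
  fixes \<V> :: "'u alg set"
  assumes V: "variety \<V>" "\<V> \<subseteq> base_zero 0 True" "base 0 True \<subseteq> \<V>" "base_zero 0 False \<subseteq> \<V>"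
    and ne: "\<not> base_zero 0 True \<subseteq> \<V>"
  shows "valid \<V> {[0 :: nat], [0, 1, 2]} [0, 1]"
proof -
  interpret S7_zero_subvariety \<V> using S7_zero_subvariety_base_zero[OF V(1,2)] .
  note same = valid_same_letters[OF V(2)]
  obtain u and q :: "'u list" where u: "ineq u q" "valid \<V> u q"
    and not: "\<not> valid (base_zero 0 True :: 'u alg set) u q"
    using ne variety_subsetI[OF inf variety_base_zero V(1)] by blast
  have "valid (base_zero 0 False :: 'u alg set) u q" using u(2) V(4) unfolding valid_def by blast
  then have w: "within u q \<noteq> {}" by (simp add: valid_base_zero_0[OF u(1)])
  then obtain y where y: "y \<in> set q" "y \<notin> letters (within u q)"
    using not by (auto simp: valid_base_zero_0[OF u(1)])
  obtain w0 where w0: "w0 \<in> within u q" using w by blast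
  then have "w0 \<noteq> []" using u(1) by (auto simp: within_def ineq_def)
  then have "hd w0 \<in> letters (within u q)"
    using w0 hd_in_set[of w0] unfolding letters_def by blast
  then have x: "hd w0 \<in> letters (within u q)" "hd w0 \<in> set q"
    using letters_within[of u q] by blast+
  define f where "f x = (if x \<in> letters (within u q) then [0] else if x \<in> set q then [1] else [0 :: nat, 1, 2])" for x
  have f: "f x \<noteq> []" "set (f x) \<subseteq> {0, 1, 2}" for x by (auto simp: f_def)
  have "set (f x) \<subseteq> {0, 1}" if "x \<in> set q" for x using that by (auto simp: f_def)
  moreover have "0 \<in> set (f (hd w0))" "1 \<in> set (f y)" using x y by (auto simp: f_def)
  ultimately have set_q: "set (subst f q) = {0, 1}" using x(2) y(1) by fastforce
  then have "subst f q \<noteq> []" by force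
  have "valid \<V> {[0], [0, 1, 2]} (subst f q)"
  proof (rule valid_cut)
    show "valid \<V> (subst f ` u) (subst f q)" using u f by (intro valid_subst) auto
    fix v assume "v \<in> subst f ` u"
    then obtain w where w: "w \<in> u" "v = subst f w" by blast
    then have "w \<noteq> []" using u(1) by (auto simp: ineq_def)
    show "valid \<V> {[0], [0, 1, 2]} v"
    proof (cases "set w \<subseteq> set q")
      case True
      then have "set w \<subseteq> letters (within u q)" using w by (auto simp: within_def letters_def)
      then have "set (f x) = {0}" if "x \<in> set w" for x using that by (auto simp: f_def)
      then have "set v = {0}" using w(2) \<open>w \<noteq> []\<close> by (cases w) auto
      then have "valid \<V> {[0]} v" by (intro same) auto
      then show ?thesis by (rule valid_mono) auto
    next
      case False
      then obtain x where x: "x \<in> set w" "x \<notin> set q" by blast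
      then have "f x = [0, 1, 2]" using letters_within[of u q] by (auto simp: f_def)
      moreover have "set (f x) \<subseteq> set v" using x(1) w(2) by auto
      ultimately have "{0, 1, 2} \<subseteq> set v" by simp
      then have "set v = {0, 1, 2}" using f(2) w(2) by auto
      then have "valid \<V> {[0, 1, 2]} v" by (intro same) auto
      then show ?thesis by (rule valid_mono) auto
    qed
  qed
  moreover have "valid \<V> {subst f q} [0, 1]" using \<open>subst f q \<noteq> []\<close> set_q by (intro same) simp_all
  ultimately show ?thesis by (rule valid_cut1)
qed

text \<open>
  In \<open>M\<^sub>2\<^sup>0\<close> a sum \<open>u\<close> lies above the product \<open>p\<close> of all its letters. Without \<open>D\<^sub>2\<close>, this
  gives \<open>q \<le> qp = p \<le> u\<close> whenever the letters of \<open>q\<close> occur in \<open>u\<close>, as in \<open>M\<^sub>2\<close>. With \<open>D\<^sub>2\<close>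
  but without \<open>M\<^sub>2\<^sup>0\<close>, it gives \<open>q = wq \<le> w + wqp \<le> u\<close> if in addition a word \<open>w\<close> of \<open>u\<close> has
  all its letters in \<open>q\<close>.
\<close>

lemma interval_M2:
  "interval (base 0 True) (base_zero 0 True) =
    {base 0 True, Var (copies M2 \<union> copies D2), base_zero 0 True :: 'u alg set}"
proof (intro equalityI subsetI)
  let ?M = "Var (copies M2 \<union> copies D2) :: 'u alg set"
  fix \<V> :: "'u alg set"
  assume "\<V> \<in> interval (base 0 True) (base_zero 0 True)"
  then have V: "variety \<V>" "base 0 True \<subseteq> \<V>" "\<V> \<subseteq> base_zero 0 True" by (auto simp: interval_def)
  interpret S7_zero_subvariety \<V> using S7_zero_subvariety_base_zero[OF V(1,3)] .
  note same = valid_same_letters[OF V(3)]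
  have all: "\<exists>p. p \<noteq> [] \<and> set p = letters u \<and> valid \<V> u p" if u: "ineq u q" for u and q :: "'u list"
  proof -
    have "finite (letters u)" using u by (auto simp: letters_def ineq_def)
    then obtain p where p: "set p = letters u" using finite_list by blast
    obtain w where "w \<in> u" "w \<noteq> []" using u by (auto simp: ineq_def)
    then have "p \<noteq> []" using p by (cases w) (auto simp: letters_def)
    then have i: "ineq u p" using u by (simp add: ineq_def)
    have "within u p = u" using p by (simp add: within_eq)
    then have "valid (base_zero 0 True :: 'u alg set) u p"
      using p u by (simp add: valid_base_zero_0[OF i] ineq_def)
    then show ?thesis using V(3) p \<open>p \<noteq> []\<close> unfolding valid_def by blast
  qed
  show "\<V> \<in> {base 0 True, ?M, base_zero 0 True}"
  proof (cases "base_zero 0 False \<subseteq> \<V>")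
    case False
    note drop = valid_drop_letter[OF V(1,3) False]
    have "\<V> \<subseteq> base 0 True"
    proof (rule variety_subsetI[OF inf V(1) variety_base])
      fix u and q :: "'u list" assume u: "ineq u q" and "valid (base 0 True :: 'u alg set) u q"
      then have q: "set q \<subseteq> letters u" "q \<noteq> []" by (simp_all add: valid_base[OF inf u] ineq_def)
      obtain p where p: "p \<noteq> []" "set p = letters u" "valid \<V> u p" using all[OF u] by blast
      have "valid \<V> {p} (q @ p)" using p q by (intro same) auto
      moreover have "valid \<V> {q @ p} q"
        using valid_subst[OF drop, of "\<lambda>i. if i = 0 then q else p"] p q by (simp add: ineq_def)
      ultimately show "valid \<V> u q" using p(3) by (meson valid_cut1)
    qed
    then show ?thesis using V by blast
  next
    case True
    show ?thesis
    proof (cases "base_zero 0 True \<subseteq> \<V>")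
      case False
      note absorb = valid_absorb_letter[OF V(1,3,2) True False]
      have "?M \<subseteq> \<V>"
      proof (rule variety_subsetI[OF inf V_M2_D2(1) V(1)])
        fix u and q :: "'u list" assume u: "ineq u q" and v: "valid \<V> u q"
        have "valid (base 0 True :: 'u alg set) u q" "valid (base_zero 0 False :: 'u alg set) u q"
          using v V(2) True unfolding valid_def by blast+
        then show "valid ?M u q"
          by (simp add: V_M2_D2(2)[OF u] valid_base[OF inf u] valid_base_zero_0[OF u])
      qed
      moreover have "\<V> \<subseteq> ?M"
      proof (rule variety_subsetI[OF inf V(1) V_M2_D2(1)])
        fix u and q :: "'u list" assume u: "ineq u q" and "valid ?M u q"
        then have q: "set q \<subseteq> letters u" "q \<noteq> []" and "within u q \<noteq> {}"
          by (simp_all add: V_M2_D2(2)[OF u] ineq_def)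
        then obtain w where w: "w \<in> u" "set w \<subseteq> set q" by (auto simp: within_def)
        then have "w \<noteq> []" using u by (auto simp: ineq_def)
        obtain p where p: "p \<noteq> []" "set p = letters u" "valid \<V> u p" using all[OF u] by blast
        have "valid \<V> {p} (w @ q @ p)" using p q w by (intro same) auto
        then have "valid \<V> u (w @ q @ p)" using p(3) by (meson valid_cut1)
        moreover have "valid \<V> {w, w @ q @ p} (w @ q)"
          using valid_subst[OF absorb, of "\<lambda>i. if i = 0 then w else if i = 1 then q else p"]
            p q \<open>w \<noteq> []\<close> by (simp add: ineq_def)
        ultimately have "valid \<V> u (w @ q)"
          using w(1) by (elim valid_cut[rotated]) (auto intro: valid_mem)
        moreover have "valid \<V> {w @ q} q" using w q by (intro same) auto
        ultimately show "valid \<V> u q" by (rule valid_cut1)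
      qed
      ultimately show ?thesis by blast
    qed (use V in blast)
  qed
next
  let ?M = "Var (copies M2 \<union> copies D2) :: 'u alg set"
  have "base 0 True \<subseteq> ?M"
    by (rule variety_subsetI[OF inf variety_base V_M2_D2(1)])
      (simp add: V_M2_D2(2) valid_base[OF inf] sat_Sc_gen_0)
  moreover have "?M \<subseteq> base_zero 0 True"
  proof (rule variety_subsetI[OF inf V_M2_D2(1) variety_base_zero])
    fix u and q :: "'u list"
    assume u: "ineq u q" and "valid (base_zero 0 True :: 'u alg set) u q"
    then show "valid ?M u q"
      using letters_within_subset[of u q] unfolding valid_base_zero_0[OF u] V_M2_D2(2)[OF u] by blast
  qed
  ultimately show "\<V> \<in> interval (base 0 True) (base_zero 0 True)"
    if "\<V> \<in> {base 0 True, ?M, base_zero 0 True}" for \<V>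
    using that variety_base[of 0 True] variety_base_zero[of 0 True] V_M2_D2(1)
      base_subset_base_zero[of 0 True]
    unfolding interval_def by blast
qed

end

theorem proposition3p33:
  fixes \<phi> :: "'u alg set \<Rightarrow> 'u alg set"
    and \<phi>_inv :: "'u alg set \<Rightarrow> 'u alg set set"
  assumes "infinite (UNIV :: 'u set)"
    and "\<phi> = (\<lambda>\<V>. \<V> \<inter> Var (copies S7))"
    and "\<phi>_inv = (\<lambda>\<W>. {\<V> \<in> subvarieties (Var (copies (adjoin_zero S7))). \<phi> \<V> = \<W>})"
  shows "\<phi>_inv trivial_variety = {trivial_variety, Var (copies D2)}
    \<and> \<phi>_inv (Var (copies M2)) =
      {Var (copies M2), Var (copies M2 \<union> copies D2), Var (copies (adjoin_zero M2))}
    \<and> \<phi>_inv (Var (copies T2)) =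
      interval (Var (copies T2)) (Var (copies (adjoin_zero T2)))
    \<and> \<phi>_inv (Var (copies Sc_alg)) =
      interval (Var (copies Sc_alg)) (Var (copies (adjoin_zero Sc_alg)))
    \<and> \<phi>_inv (Var (copies M2 \<union> copies T2)) =
      interval (Var (copies M2 \<union> copies T2))
        (Var (copies (adjoin_zero M2) \<union> copies (adjoin_zero T2)))
    \<and> \<phi>_inv (Var (copies M2 \<union> copies Sc_alg)) =
      interval (Var (copies M2 \<union> copies Sc_alg))
        (Var (copies (adjoin_zero M2) \<union> copies (adjoin_zero Sc_alg)))"
proof -
  note inf = assms(1)
  have preimage: "\<phi>_inv (base n m) = interval (base n m) (base_zero n m)" if "n \<le> 2" for n m
    unfolding assms(2,3) using preimage_eq_interval[OF inf that] by simp
  have "\<forall>(u :: 'u list set) q. ineq u q \<longrightarrow> (sat T2 u q \<longleftrightarrow> sat (Sc_gen 1) u q)"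
    using sat_T2_iff by blast
  note T2 = V_eq_base[OF inf ai_semiring_T2 finite_carrier_T2 this]
  have "\<forall>(u :: 'u list set) q. ineq u q \<longrightarrow> (sat Sc_alg u q \<longleftrightarrow> sat (Sc_gen 2) u q)"
    using sat_Sc_alg_iff by blast
  note Sc = V_eq_base[OF inf ai_semiring_Sc finite_carrier_Sc_alg this]
  show ?thesis
    unfolding trivial_variety_eq_base[OF inf] V_D2_eq_base_zero[OF inf] V_M2_eq_base[OF inf]
      V_M2_zero_eq_base_zero[OF inf] T2 Sc
    using preimage interval_trivial[OF inf] interval_M2[OF inf] by simp
qed

end
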